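(* Let $G$ be a finite simple graph with maximum degree $\Delta\geq 3$. Let $P$ be a solvable pebble distribution on $G$, and let $U_1,\dots,U_t$ be the unit distributions obtained by restricting $P$ to its occupied vertices (so $P=\sum_i U_i$, the $U_i$ are pairwise disjoint, each $U_i$ has all its pebbles on a single vertex), indexed so that $|U_i|\leq |U_{i+1}|$. Then $$\sum_{i=1}^t\mathrm{CE}\Big(\sum_{k=1}^{i-1}U_k,\,U_i\Big)\geq \frac{|V(G)|-\sum_{i=1}^t \mathrm{cov}(U_i)}{\Delta-2}.$$
   Context: A pebble distribution is a function $V(G)\to\mathbb{Z}_{\geq0}$ with size $|P|=\sum_vP(v)$; $(P+Q)(v)=P(v)+Q(v)$; the empty sum is the zero distribution. A unit is a distribution with pebbles on only one vertex; $P,Q$ are disjoint if no vertex has pebbles under both. A pebbling move removes two pebbles from a vertex and adds one to an adjacent vertex. A vertex $v$ is $k$-reachable under $P$ if some executable sequence of pebbling moves yields at least $k$ pebbles on $v$; reachable means $1$-reachable; $P$ is solvable if every vertex is reachable. $\mathrm{cov}(P)$ is the number of vertices reachable under $P$. $\mathrm{reach}(P,v)$ is the largest $k$ with $v$ $k$-reachable; $\mathrm{exc}(P,v)=\mathrm{reach}(P,v)-1$ if $v$ is reachable and $0$ otherwise; $\mathrm{TE}(P)=\sum_v\mathrm{exc}(P,v)$; $\mathrm{CE}(P,Q)=\mathrm{TE}(P+Q)-\mathrm{TE}(P)-\mathrm{TE}(Q)$. *)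

theory Defs
  imports Complex_Main
begin

definition simple_graph :: "'a set \<Rightarrow> ('a \<Rightarrow> 'a \<Rightarrow> bool) \<Rightarrow> bool" where
  "simple_graph V E \<longleftrightarrow> finite V \<and> (\<forall>u v. E u v \<longrightarrow> u \<in> V \<and> v \<in> V)
     \<and> (\<forall>u v. E u v \<longrightarrow> E v u) \<and> (\<forall>v. \<not> E v v)"

definition degree :: "'a set \<Rightarrow> ('a \<Rightarrow> 'a \<Rightarrow> bool) \<Rightarrow> 'a \<Rightarrow> nat" where
  "degree V E v = card {u \<in> V. E v u}"

definition max_degree :: "'a set \<Rightarrow> ('a \<Rightarrow> 'a \<Rightarrow> bool) \<Rightarrow> nat" where
  "max_degree V E = Max (degree V E ` V)"

type_synonym 'a dist = "'a \<Rightarrow> nat"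

definition is_dist :: "'a set \<Rightarrow> 'a dist \<Rightarrow> bool" where
  "is_dist V P \<longleftrightarrow> (\<forall>v. v \<notin> V \<longrightarrow> P v = 0)"


definition peb_move :: "('a \<Rightarrow> 'a \<Rightarrow> bool) \<Rightarrow> 'a dist \<Rightarrow> 'a dist \<Rightarrow> bool" where
  "peb_move E P Q \<longleftrightarrow> (\<exists>u v. E u v \<and> 2 \<le> P u \<and> Q = (P(u := P u - 2))(v := P v + 1))"

abbreviation peb_moves :: "('a \<Rightarrow> 'a \<Rightarrow> bool) \<Rightarrow> 'a dist \<Rightarrow> 'a dist \<Rightarrow> bool" where
  "peb_moves E \<equiv> (peb_move E)\<^sup>*\<^sup>*"

definition k_reachable :: "('a \<Rightarrow> 'a \<Rightarrow> bool) \<Rightarrow> 'a dist \<Rightarrow> 'a \<Rightarrow> nat \<Rightarrow> bool" where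
  "k_reachable E P v k \<longleftrightarrow> (\<exists>Q. peb_moves E P Q \<and> k \<le> Q v)"

definition reachable :: "('a \<Rightarrow> 'a \<Rightarrow> bool) \<Rightarrow> 'a dist \<Rightarrow> 'a \<Rightarrow> bool" where
  "reachable E P v \<longleftrightarrow> k_reachable E P v 1"

definition solvable :: "'a set \<Rightarrow> ('a \<Rightarrow> 'a \<Rightarrow> bool) \<Rightarrow> 'a dist \<Rightarrow> bool" where
  "solvable V E P \<longleftrightarrow> (\<forall>v\<in>V. reachable E P v)"

definition cov :: "'a set \<Rightarrow> ('a \<Rightarrow> 'a \<Rightarrow> bool) \<Rightarrow> 'a dist \<Rightarrow> nat" where
  "cov V E P = card {v \<in> V. reachable E P v}"

definition reach :: "('a \<Rightarrow> 'a \<Rightarrow> bool) \<Rightarrow> 'a dist \<Rightarrow> 'a \<Rightarrow> nat" where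
  "reach E P v = (GREATEST k. k_reachable E P v k)"

definition exc :: "('a \<Rightarrow> 'a \<Rightarrow> bool) \<Rightarrow> 'a dist \<Rightarrow> 'a \<Rightarrow> int" where
  "exc E P v = (if reachable E P v then int (reach E P v) - 1 else 0)"

definition TE :: "'a set \<Rightarrow> ('a \<Rightarrow> 'a \<Rightarrow> bool) \<Rightarrow> 'a dist \<Rightarrow> int" where
  "TE V E P = (\<Sum>v\<in>V. exc E P v)"

definition CE :: "'a set \<Rightarrow> ('a \<Rightarrow> 'a \<Rightarrow> bool) \<Rightarrow> 'a dist \<Rightarrow> 'a dist \<Rightarrow> int" where
  "CE V E P Q = TE V E (\<lambda>v. P v + Q v) - TE V E P - TE V E Q"

definition unit_at :: "'a dist \<Rightarrow> 'a \<Rightarrow> 'a dist" where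
  "unit_at P w = (\<lambda>x. if x = w then P w else 0)"

end

theory Submission
  imports Defs "HOL-Library.Multiset"
begin

text \<open>
The cooperation excesses telescope, so the claim reads
\<open>|V| \<le> \<Sum>\<^sub>k cov U\<^sub>k + (\<Delta> - 2) (TE P - \<Sum>\<^sub>k TE U\<^sub>k)\<close> and the order of the units is irrelevant.
Let the surplus of a vertex be its contribution to \<open>TE P - \<Sum>\<^sub>k TE U\<^sub>k\<close>. A vertex covered by no
single unit can only be fed by a \<^emph>\<open>boosted\<close> vertex: one that receives two pebbles from \<open>P\<close> but at
most one from every unit; it has positive surplus. Each boosted vertex has at most \<open>\<Delta>\<close> neighbours,
and it must itself be fed by neighbours to which two pebbles are cheaper to bring, so that two of
its \<open>\<Delta>\<close> edges are used up, except in two situations. If an uncovered boosted vertex is fed by one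
boosted vertex only, the latter can collect four pebbles and its additional surplus pays. If a
boosted vertex is fed by a single \<^emph>\<open>rich\<close> vertex (one that gets two pebbles from some unit), that
vertex has positive surplus as well, and the connected components of such rich vertices pay: by the
tree bound on their edges a component lacks at most 2, which it recovers from vertices covered
twice, from further edges leaving it, or from a boosted neighbour.
\<close>

section \<open>Pebbling moves and pebbling trees\<close>

text \<open>In the claim one unit of surplus is worth \<open>d\<close> = \<Delta> - 2, but a boosted
  vertex of surplus 1 may have d + 2 edges that lead to uncovered vertices; hence two of them must
  be saved. An edge along which one boosted vertex supplies another is useless at both ends and so
  saves two at once, whereas an edge to a rich vertex saves only one; this is why a lone rich
  neighbour is exceptional. The count would fail if an edge could supply in both directions.
  Deliveries are therefore recorded as trees instead of move sequences, and each boosted vertex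
  fixes a pair of trees with the fewest moves: its suppliers then have strictly cheaper pairs. The
  same minimality breaks the other circles, by looking at the cheapest vertex among those that
  depend on a given vertex or component. The pebbles of one unit gain nothing from cooperation: by a
  weight argument they may all follow one shortest walk. This makes a component of small gain rigid:
  a single unit, placed inside it, brings two pebbles to each of its vertices.\<close>

lemma peb_moves_add:
  "peb_moves E A B \<Longrightarrow> peb_moves E (\<lambda>v. A v + R v) (\<lambda>v. B v + R v)"
proof (induction rule: rtranclp_induct)
  case base
  then show ?case by simp
next
  case (step B C)
  from step(2) obtain u v where "E u v" "2 \<le> B u" "C = (B(u := B u - 2))(v := B v + 1)"
    unfolding peb_move_def by blast
  then have "peb_move E (\<lambda>v. B v + R v) (\<lambda>v. C v + R v)"
    unfolding peb_move_def by (intro exI[of _ u] exI[of _ v]) (auto simp: fun_eq_iff)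
  then show ?case using step.IH by (meson rtranclp.rtrancl_into_rtrancl)
qed

lemma k_reachable_mono:
  assumes "k_reachable E A v k" "\<And>x. A x \<le> B x" "j \<le> k"
  shows "k_reachable E B v j"
proof -
  obtain Q where Q: "peb_moves E A Q" "k \<le> Q v"
    using assms(1) unfolding k_reachable_def by blast
  have "(\<lambda>x. A x + (B x - A x)) = B" using assms(2) by auto
  with peb_moves_add[OF Q(1), of "\<lambda>x. B x - A x"]
  have "peb_moves E B (\<lambda>x. Q x + (B x - A x))" by simp
  then show ?thesis unfolding k_reachable_def using Q(2) assms(3)
    by (intro exI[of _ "\<lambda>x. Q x + (B x - A x)"]) auto
qed

lemma k_reachable_add:
  assumes "k_reachable E A v j" "k_reachable E B v k"
  shows "k_reachable E (\<lambda>x. A x + B x) v (j + k)"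
proof -
  obtain Q R where Q: "peb_moves E A Q" "j \<le> Q v" and R: "peb_moves E B R" "k \<le> R v"
    using assms unfolding k_reachable_def by blast
  have "peb_moves E (\<lambda>x. A x + B x) (\<lambda>x. Q x + B x)" by (rule peb_moves_add[OF Q(1)])
  also have "peb_moves E (\<lambda>x. Q x + B x) (\<lambda>x. Q x + R x)"
    using peb_moves_add[OF R(1), of Q] by (simp add: add.commute)
  finally show ?thesis using Q(2) R(2) unfolding k_reachable_def
    by (intro exI[of _ "\<lambda>x. Q x + R x"]) auto
qed

lemma k_reachable_initial: "k_reachable E D v (D v)"
  unfolding k_reachable_def by blast

lemma k_reachable_trans:
  assumes "peb_moves E A B" "k_reachable E B v k"
  shows "k_reachable E A v k"
  using assms unfolding k_reachable_def by (meson rtranclp_trans)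

lemma repeated_moves:
  assumes "E x v" "x \<noteq> v" "2 * j \<le> D x"
  shows "\<exists>D'. peb_moves E D D' \<and> j \<le> D' v"
  using assms(3)
proof (induction j arbitrary: D)
  case 0
  then show ?case by blast
next
  case (Suc j)
  let ?D = "(D(x := D x - 2))(v := D v + 1)"
  have "2 * j \<le> D x - 2" using Suc.prems by simp
  \<comment> \<open>Only the pebbles left on \<open>x\<close> are handed to the induction
    hypothesis. The pebble just moved to \<open>v\<close> is set aside and added back, since the
    hypothesis promises no more than \<open>j\<close> pebbles on \<open>v\<close>.\<close>
  then obtain D' where D': "peb_moves E (\<lambda>y. if y = x then D x - 2 else 0) D'" "j \<le> D' v"
    using Suc.IH[of "\<lambda>y. if y = x then D x - 2 else 0"] by auto
  have "peb_move E D ?D" using assms(1) Suc.prems unfolding peb_move_def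
    by (intro exI[of _ x] exI[of _ v]) auto
  moreover have "?D = (\<lambda>y. (if y = x then D x - 2 else 0)
      + (?D y - (if y = x then D x - 2 else 0)))"
    using assms(2) by (auto simp: fun_eq_iff)
  then have "peb_moves E ?D (\<lambda>y. D' y + (?D y - (if y = x then D x - 2 else 0)))"
    using peb_moves_add[OF D'(1), of "\<lambda>y. ?D y - (if y = x then D x - 2 else 0)"] by simp
  ultimately have "peb_moves E D (\<lambda>y. D' y + (?D y - (if y = x then D x - 2 else 0)))"
    by (meson converse_rtranclp_into_rtranclp)
  then show ?case using D'(2) assms(2) by (intro exI conjI) auto
qed

text \<open>A tree records how one pebble on its apex arises: a leaf is an initial pebble, a node a move
of the two pebbles produced by its subtrees.\<close>
datatype 'a ptree = Leaf 'a | Node 'a "'a ptree" "'a ptree"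

primrec apex :: "'a ptree \<Rightarrow> 'a" where
  "apex (Leaf v) = v"
| "apex (Node v l r) = v"

primrec leaf_count :: "'a ptree \<Rightarrow> 'a \<Rightarrow> nat" where
  "leaf_count (Leaf v) x = (if x = v then 1 else 0)"
| "leaf_count (Node v l r) x = leaf_count l x + leaf_count r x"

primrec pebbling_tree :: "('a \<Rightarrow> 'a \<Rightarrow> bool) \<Rightarrow> 'a ptree \<Rightarrow> bool" where
  "pebbling_tree E (Leaf v) = True"
| "pebbling_tree E (Node v l r) = (pebbling_tree E l \<and> pebbling_tree E r \<and> apex l = apex r
  \<and> E (apex l) v)"

primrec kids :: "'a ptree \<Rightarrow> 'a ptree multiset" where
  "kids (Leaf v) = {#}"
| "kids (Node v l r) = {#l, r#}"

text \<open>The leaf bound concerns all trees together, so that they can be carried out side by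
  side. A forest of size \<open>k\<close> thus certifies that \<open>k\<close> pebbles can be
  brought to \<open>v\<close>, in a form that can be minimised and cut.\<close>

definition forest :: "('a \<Rightarrow> 'a \<Rightarrow> bool) \<Rightarrow> 'a dist \<Rightarrow> 'a \<Rightarrow> 'a ptree multiset \<Rightarrow> bool" where
  "forest E D v M \<longleftrightarrow> (\<forall>t\<in>#M. pebbling_tree E t \<and> apex t = v) \<and> (\<forall>x. (\<Sum>t\<in>#M. leaf_count t x) \<le> D x)"

abbreviation all_kids :: "'a ptree multiset \<Rightarrow> 'a ptree multiset" where
  "all_kids M \<equiv> (\<Sum>t\<in>#M. kids t)"

text \<open>As \<open>size\<close> counts inner nodes, this is the number of recorded moves.\<close>

definition cost :: "'a ptree multiset \<Rightarrow> nat" where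
  "cost M = (\<Sum>t\<in>#M. size t)"

text \<open>The bystander \<open>R\<close> carries the induction: it holds the leaves of one subtree
  while the other is carried out.\<close>

lemma tree_moves:
  "pebbling_tree E t \<Longrightarrow> (\<And>x. \<not> E x x) \<Longrightarrow>
    peb_moves E (\<lambda>x. leaf_count t x + R x) (\<lambda>x. (if x = apex t then 1 else 0) + R x)"
proof (induction t arbitrary: R)
  case (Leaf v)
  then show ?case by simp
next
  case (Node v l r)
  let ?x = "apex l"
  let ?e = "\<lambda>x. if x = ?x then (1::nat) else 0"
  have "peb_moves E (\<lambda>x. leaf_count l x + (leaf_count r x + R x)) (\<lambda>x. ?e x + (leaf_count r x
    + R x))"
    using Node by simp
  moreover have "peb_moves E (\<lambda>x. ?e x + (leaf_count r x + R x)) (\<lambda>x. ?e x + (?e x + R x))"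
    using Node.IH(2)[of "\<lambda>x. ?e x + R x"] Node.prems by (simp add: algebra_simps)
  ultimately have "peb_moves E (\<lambda>x. leaf_count l x + (leaf_count r x + R x)) (\<lambda>x. ?e x + (?e x
    + R x))"
    by (metis (no_types, lifting) rtranclp_trans)
  moreover have "peb_move E (\<lambda>x. ?e x + (?e x + R x)) (\<lambda>x. (if x = v then 1 else 0) + R x)"
    unfolding peb_move_def using Node.prems
    by (intro exI[of _ ?x] exI[of _ v]) (auto simp: fun_eq_iff)
  ultimately have "peb_moves E (\<lambda>x. leaf_count l x + (leaf_count r x + R x)) (\<lambda>x. (if x
    = v then 1 else 0) + R x)"
    by (meson rtranclp.rtrancl_into_rtrancl)
  then show ?case by (simp add: algebra_simps)
qed

lemma forest_moves:
  assumes "\<forall>t\<in>#M. pebbling_tree E t \<and> apex t = v" "\<And>x. \<not> E x x"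
  shows "peb_moves E (\<lambda>x. (\<Sum>t\<in>#M. leaf_count t x) + R x) (\<lambda>x. (if x = v then size M else 0) + R x)"
  using assms(1)
proof (induction M arbitrary: R)
  case empty
  have "(\<lambda>x. (if x = v then size ({#} :: 'a ptree multiset) else 0) + R x) = R" by auto
  moreover have "(\<lambda>x. (\<Sum>t\<in>#{#}. leaf_count t x) + R x) = R" by auto
  ultimately show ?case by (simp only: rtranclp.rtrancl_refl)
next
  case (add t M)
  have "peb_moves E (\<lambda>x. leaf_count t x + ((\<Sum>t\<in>#M. leaf_count t x) + R x))
      (\<lambda>x. (if x = v then 1 else 0) + ((\<Sum>t\<in>#M. leaf_count t x) + R x))"
    using tree_moves[of E t] add.prems assms(2) by auto
  moreover have "peb_moves E (\<lambda>x. (if x = v then 1 else 0) + ((\<Sum>t\<in>#M. leaf_count t x) + R x))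
      (\<lambda>x. (if x = v then size M else 0) + ((if x = v then 1 else 0) + R x))"
    using add.IH[of "\<lambda>x. (if x = v then 1 else 0) + R x"] add.prems by (simp add: algebra_simps)
  ultimately have "peb_moves E (\<lambda>x. leaf_count t x + ((\<Sum>t\<in>#M. leaf_count t x) + R x))
      (\<lambda>x. (if x = v then size M else 0) + ((if x = v then 1 else 0) + R x))"
    by (metis (no_types, lifting) rtranclp_trans)
  moreover have "(\<lambda>x. (if x = v then size M else 0) + ((if x = v then 1 else 0) + R x))
     = (\<lambda>x. (if x = v then size (add_mset t M) else 0) + R x)" by (auto simp: fun_eq_iff)
  ultimately show ?case by (simp add: algebra_simps)
qed

lemma forest_k_reachable:
  assumes "forest E D v M" "\<And>x. \<not> E x x"
  shows "k_reachable E D v (size M)"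
proof -
  have le: "\<And>x. (\<Sum>t\<in>#M. leaf_count t x) \<le> D x" and tr: "\<forall>t\<in>#M. pebbling_tree E t \<and> apex t = v"
    using assms unfolding forest_def by auto
  have "k_reachable E (\<lambda>x. \<Sum>t\<in>#M. leaf_count t x) v (size M)"
    unfolding k_reachable_def using forest_moves[OF tr assms(2), of "\<lambda>_. 0"]
    by (intro exI[of _ "\<lambda>x. if x = v then size M else 0"]) auto
  then show ?thesis using le by (rule k_reachable_mono) simp
qed

lemma forest_mono: "forest E D v M \<Longrightarrow> (\<And>x. D x \<le> D' x) \<Longrightarrow> forest E D' v M"
  unfolding forest_def by (meson le_trans)

lemma sum_mset_mono_subset:
  fixes f :: "'b \<Rightarrow> nat"
  assumes "M' \<subseteq># M" shows "(\<Sum>t\<in>#M'. f t) \<le> (\<Sum>t\<in>#M. f t)"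
proof -
  have "M = M' + (M - M')" using assms by simp
  then show ?thesis by (metis image_mset_union le_add1 sum_mset.union)
qed

lemma exists_submultiset_of_size:
  "k \<le> size M \<Longrightarrow> \<exists>M'. M' \<subseteq># M \<and> size M' = k"
proof (induction M arbitrary: k)
  case (add x M)
  show ?case
  proof (cases "k = size (add_mset x M)")
    case True
    then show ?thesis by blast
  next
    case False
    then obtain M' where "M' \<subseteq># M" "size M' = k" using add.IH[of k] add.prems by auto
    then show ?thesis by (metis add_mset_add_single mset_subset_eq_add_left subset_mset.order_trans)
  qed
qed simp

text \<open>Every pebble on the board carries the tree of its history. A move from \<open>u\<close>
  to \<open>v\<close> joins two trees with apex \<open>u\<close> under a new node at
  \<open>v\<close> and uses no further leaves.\<close>

lemma moves_forest:
  assumes "finite {x. D x > 0}" "peb_moves E D Q" "\<And>x. \<not> E x x"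
  shows "\<exists>M. (\<forall>t\<in>#M. pebbling_tree E t) \<and> (\<forall>x. count (image_mset apex M) x = Q x)
    \<and> (\<forall>x. (\<Sum>t\<in>#M. leaf_count t x) \<le> D x)"
  using assms(2)
proof (induction rule: rtranclp_induct)
  case base
  define A where "A = Abs_multiset D"
  have A: "count A = D" unfolding A_def using assms(1) by (simp add: Abs_multiset_inverse)
  have "(\<Sum>t\<in>#image_mset Leaf B. leaf_count t x) = count B x" for x and B :: "'a multiset"
    by (induction B) auto
  then show ?case using A by (intro exI[of _ "image_mset Leaf A"])
    (auto simp: image_mset.compositionality o_def)
next
  case (step Q Q')
  then obtain M where M: "\<forall>t\<in>#M. pebbling_tree E t" "\<And>x. count (image_mset apex M) x = Q x"
     "\<And>x. (\<Sum>t\<in>#M. leaf_count t x) \<le> D x" by blast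
  from step(2) obtain u v where uv: "E u v" "2 \<le> Q u" "Q' = (Q(u := Q u - 2))(v := Q v + 1)"
    unfolding peb_move_def by blast
  have "u \<in># image_mset apex M" using M(2)[of u] uv(2)
    by (metis count_greater_zero_iff less_le_trans zero_less_numeral)
  then obtain l M1 where l: "M = add_mset l M1" "apex l = u"
    by (metis (no_types, lifting) imageE in_image_mset multi_member_split)
  have "count (image_mset apex M) u = Suc (count (image_mset apex M1) u)" using l by simp
  then have "count (image_mset apex M1) u \<ge> 1" using M(2)[of u] uv(2) by linarith
  then have "u \<in># image_mset apex M1" by (simp only: count_greater_eq_one_iff)
  then obtain r M2 where r: "M1 = add_mset r M2" "apex r = u"
    by (metis (no_types, lifting) imageE in_image_mset multi_member_split)
  let ?M = "add_mset (Node v l r) M2"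
  have "\<forall>t\<in>#?M. pebbling_tree E t" using M(1) l r uv by auto
  moreover have "count (image_mset apex ?M) x = Q' x" for x
    using M(2)[of x] M(2)[of v] M(2)[of u] l r uv by (cases "u = v") (auto simp: assms(3))
  moreover have "(\<Sum>t\<in>#?M. leaf_count t x) \<le> D x" for x
    using M(3)[of x] l r by simp
  ultimately show ?case by blast
qed

lemma k_reachable_forest:
  assumes "finite {x. D x > 0}" "k_reachable E D v k" "\<And>x. \<not> E x x"
  shows "\<exists>M. forest E D v M \<and> size M = k"
proof -
  obtain Q where Q: "peb_moves E D Q" "k \<le> Q v" using assms(2) unfolding k_reachable_def by blast
  obtain M where M: "\<forall>t\<in>#M. pebbling_tree E t" "\<And>x. count (image_mset apex M) x = Q x"
     "\<And>x. (\<Sum>t\<in>#M. leaf_count t x) \<le> D x"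
    using moves_forest[OF assms(1) Q(1) assms(3)] by blast
  let ?M = "filter_mset (\<lambda>t. apex t = v) M"
  have "size ?M = Q v" unfolding M(2)[symmetric]
    by (induction M) auto
  then obtain M' where M': "M' \<subseteq># ?M" "size M' = k"
    using Q(2) exists_submultiset_of_size[of k ?M] by auto
  then have sub: "M' \<subseteq># M" by (meson multiset_filter_subset subset_mset.order_trans)
  have "(\<Sum>t\<in>#M'. leaf_count t x) \<le> D x" for x
    using sum_mset_mono_subset[OF sub] M(3) le_trans by blast
  moreover have "\<forall>t\<in>#M'. pebbling_tree E t \<and> apex t = v"
    using M'(1) M(1) by (auto dest!: mset_subset_eqD)
  ultimately show ?thesis using M'(2) unfolding forest_def by blast
qed

lemma all_kids_leaf_count:
  "(\<Sum>t\<in>#all_kids M. leaf_count t x) \<le> (\<Sum>t\<in>#M. leaf_count t x)"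
proof (induction M)
  case (add t M)
  then show ?case by (cases t) auto
qed simp

lemma all_kids_tree:
  assumes "\<forall>t\<in>#M. pebbling_tree E t" "k \<in># all_kids M"
  shows "pebbling_tree E k"
  using assms
proof (induction M)
  case (add t M)
  then show ?case by (cases t) auto
qed simp

lemma forest_all_kids:
  assumes "forest E D v M" "\<And>k. k \<in># all_kids M \<Longrightarrow> apex k = x"
  shows "forest E D x (all_kids M)"
proof -
  have "(\<Sum>t\<in>#all_kids M. leaf_count t y) \<le> D y" for y
    using all_kids_leaf_count[of y M] assms(1) unfolding forest_def by (meson le_trans)
  then show ?thesis using assms all_kids_tree[of M E] unfolding forest_def by blast
qed

lemma cost_all_kids: "cost (all_kids M) \<le> cost M"
  unfolding cost_def
proof (induction M)
  case (add t M)
  then show ?case by (cases t) auto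
qed simp

text \<open>A tree with apex \<open>v\<close> is a node with two kids or a leaf that consumes an
  initial pebble of \<open>v\<close>; there are at most \<open>D v\<close> of the latter.\<close>

lemma size_all_kids:
  assumes "forest E D v M"
  shows "2 * size M \<le> size (all_kids M) + 2 * D v"
proof -
  have "\<forall>t\<in>#M. apex t = v" using assms unfolding forest_def by auto
  then have "2 * size M \<le> size (all_kids M) + 2 * (\<Sum>t\<in>#M. leaf_count t v)"
  proof (induction M)
    case (add t M)
    then show ?case by (cases t) auto
  qed simp
  moreover have "(\<Sum>t\<in>#M. leaf_count t v) \<le> D v" using assms unfolding forest_def by auto
  ultimately show ?thesis by linarith
qed

lemma forest_has_kid:
  assumes "forest E D v M" "D v < size M"
  shows "\<exists>k. k \<in># all_kids M"
proof -
  have "0 < size (all_kids M)" using size_all_kids[OF assms(1)] assms(2) by linarith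
  then have "all_kids M \<noteq> {#}" by (simp only: nonempty_has_size)
  then show ?thesis by (rule multiset_nonemptyE) blast
qed

text \<open>The two kids of one node form a forest of size 2 on their common apex, cheaper by at
  least that node. This strict drop makes \<open>min_cost\<close> decrease towards
  suppliers.\<close>

lemma kid_pair:
  assumes "forest E D v M" "k \<in># all_kids M"
  shows "\<exists>l r. Node v l r \<in># M \<and> apex l = apex k \<and> apex r = apex k \<and> E (apex k) v
     \<and> forest E D (apex k) {#l, r#} \<and> cost {#l, r#} < cost M"
proof -
  obtain t where t: "t \<in># M" "k \<in># kids t"
    using assms(2) by (auto simp: in_Union_mset_iff)
  then obtain w l r where tn: "t = Node w l r" by (cases t) auto
  then have k: "k = l \<or> k = r" using t(2) by auto
  have pt: "pebbling_tree E t" "apex t = v" using assms(1) t(1) unfolding forest_def by auto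
  then have w: "w = v" using tn by simp
  obtain M' where M': "M = add_mset t M'" using t(1) by (meson multi_member_split)
  have "(\<Sum>t\<in>#M. leaf_count t x) \<le> D x" for x using assms(1) unfolding forest_def by auto
  then have "(\<Sum>t\<in>#{#l, r#}. leaf_count t x) \<le> D x" for x
    using M' tn by (metis (no_types, lifting) add_leD1 image_mset_add_mset image_mset_empty
      leaf_count.simps(2)
     sum_mset.add_mset sum_mset.empty add.right_neutral)
  then have "forest E D (apex k) {#l, r#}" unfolding forest_def using pt tn k by auto
  moreover have "cost {#l, r#} < cost M" unfolding cost_def using M' tn by simp
  ultimately show ?thesis using pt tn k t(1) w by (intro exI[of _ l] exI[of _ r]) auto
qed

lemma leaf_count_forest:
  assumes "t \<in># M" "forest E D v M"
  shows "pebbling_tree E t" "apex t = v" "leaf_count t x \<le> D x" "size t \<le> cost M"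
proof -
  obtain M' where "M = add_mset t M'" using assms(1) by (meson multi_member_split)
  moreover have "(\<Sum>t\<in>#M. leaf_count t x) \<le> D x" using assms(2) unfolding forest_def by auto
  ultimately show "leaf_count t x \<le> D x" "size t \<le> cost M" unfolding cost_def by auto
  show "pebbling_tree E t" "apex t = v" using assms unfolding forest_def by auto
qed

text \<open>If pebbles enter \<open>Q\<close> only along the edge from \<open>x\<close> to \<open>y\<close>, cutting a tree there replaces each
entering pair of pebbles on \<open>x\<close> by an initial pebble on \<open>y\<close>.\<close>
lemma cut_tree:
  assumes leaf: "\<And>v. v \<in> Q \<Longrightarrow> D v = 0"
    and enter: "\<And>q l r. q \<in> Q \<Longrightarrow> E (apex l) q \<Longrightarrow> apex l \<notin> Q \<Longrightarrow> apex r = apex l \<Longrightarrow> pebbling_tree E l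
       \<Longrightarrow> pebbling_tree E r \<Longrightarrow> (\<And>z. leaf_count l z + leaf_count r z \<le> D z) \<Longrightarrow> size l + size r < n \<Longrightarrow>
         apex l = x \<and> q = y"
  shows "pebbling_tree E t \<Longrightarrow> apex t \<in> Q \<Longrightarrow> (\<And>z. leaf_count t z \<le> D z) \<Longrightarrow> size t \<le> n \<Longrightarrow>
    \<exists>t' X. pebbling_tree E t' \<and> apex t' = apex t \<and> (\<forall>k\<in>#X. pebbling_tree E k \<and> apex k = x)
      \<and> (\<forall>z. (\<Sum>k\<in>#X. leaf_count k z) \<le> leaf_count t z) \<and> (\<forall>z. z \<noteq> y \<longrightarrow> leaf_count t' z = 0)
      \<and> 2 * leaf_count t' y \<le> size X"
proof (induction t)
  case (Leaf v)
  have "D v = 0" using leaf Leaf.prems by simp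
  then show ?case using Leaf.prems(3)[of v] by simp
next
  case (Node q l r)
  have ap: "apex r = apex l" "E (apex l) q" "pebbling_tree E l" "pebbling_tree E r" "q \<in> Q"
    using Node.prems by auto
  have lr: "leaf_count l z + leaf_count r z \<le> D z" for z using Node.prems(3)[of z] by simp
  have sz: "size l + size r < n" using Node.prems(4) by simp
  show ?case
  proof (cases "apex l \<in> Q")
    case True
    have le: "\<And>z. leaf_count l z \<le> D z" "\<And>z. leaf_count r z \<le> D z" using lr
      by (meson add_leD1 add_leD2)+
    have szs: "size l \<le> n" "size r \<le> n" "apex r \<in> Q" using sz True ap by auto
    obtain l' X where l: "pebbling_tree E l'" "apex l' = apex l"
      "\<forall>k\<in>#X. pebbling_tree E k \<and> apex k = x"
        "\<forall>z. (\<Sum>k\<in>#X. leaf_count k z) \<le> leaf_count l z" "\<forall>z. z \<noteq> y \<longrightarrow> leaf_count l' z = 0"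
          "2 * leaf_count l' y \<le> size X"
      using Node.IH(1)[OF ap(3) True le(1) szs(1)] by blast
    obtain r' Y where r: "pebbling_tree E r'" "apex r' = apex r"
      "\<forall>k\<in>#Y. pebbling_tree E k \<and> apex k = x"
        "\<forall>z. (\<Sum>k\<in>#Y. leaf_count k z) \<le> leaf_count r z" "\<forall>z. z \<noteq> y \<longrightarrow> leaf_count r' z = 0"
          "2 * leaf_count r' y \<le> size Y"
      using Node.IH(2)[OF ap(4) szs(3) le(2) szs(2)] by blast
    have "(\<Sum>k\<in>#X + Y. leaf_count k z) \<le> leaf_count l z + leaf_count r z" for z
      using l(4) r(4) by (simp add: add_mono)
    then show ?thesis using l r ap by (intro exI[of _ "Node q l' r'"] exI[of _ "X + Y"]) auto
  next
    case False
    then have "apex l = x" "q = y" using enter[OF ap(5,2) False ap(1,3,4) lr sz] by auto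
    then show ?thesis using ap by (intro exI[of _ "Leaf q"] exI[of _ "{#l, r#}"]) auto
  qed
qed

text \<open>The cut trees have leaves on \<open>y\<close> only, and the pairs cut off are gathered
  in \<open>X\<close>, which still fits into \<open>D\<close>. Because of the bound
  \<open>n\<close>, \<open>enter\<close> is required only for pairs cheaper than \<open>n\<close>;
  minimality of a cost will supply it.\<close>

lemma cut_forest:
  assumes leaf: "\<And>v. v \<in> Q \<Longrightarrow> D v = 0"
    and enter: "\<And>q l r. q \<in> Q \<Longrightarrow> E (apex l) q \<Longrightarrow> apex l \<notin> Q \<Longrightarrow> apex r = apex l \<Longrightarrow> pebbling_tree E l
       \<Longrightarrow> pebbling_tree E r \<Longrightarrow> (\<And>z. leaf_count l z + leaf_count r z \<le> D z) \<Longrightarrow> size l + size r < n \<Longrightarrow>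
         apex l = x \<and> q = y"
    and M: "forest E D v M" "v \<in> Q" "cost M \<le> n"
  shows "\<exists>M' X. size M' = size M \<and> forest E (\<lambda>z. if z = y then size X div 2 else 0) v M'
    \<and> forest E D x X"
proof -
  have tr: "\<forall>t\<in>#M. pebbling_tree E t \<and> apex t = v \<and> (\<forall>z. leaf_count t z \<le> D z) \<and> size t \<le> n"
    using leaf_count_forest[OF _ M(1)] M(3) by (meson le_trans)
  have "N \<subseteq># M \<Longrightarrow> \<exists>M' X. size M' = size N \<and> (\<forall>t\<in>#M'. pebbling_tree E t \<and> apex t = v)
    \<and> (\<forall>k\<in>#X. pebbling_tree E k \<and> apex k = x)
     \<and> (\<forall>z. (\<Sum>k\<in>#X. leaf_count k z) \<le> (\<Sum>t\<in>#N. leaf_count t z)) \<and> (\<forall>z. z \<noteq> y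
       \<longrightarrow> (\<Sum>t\<in>#M'. leaf_count t z) = 0)
      \<and> 2 * (\<Sum>t\<in>#M'. leaf_count t y) \<le> size X" for N
  proof (induction N)
    case empty
    then show ?case by (intro exI[of _ "{#}"]) auto
  next
    case (add t N)
    have t: "t \<in># M" using add.prems by (meson insert_subset_eq_iff)
    have "N \<subseteq># M" using add.prems by (meson mset_subset_eq_insertD subset_mset.less_imp_le)
    then obtain M' X where IH: "size M' = size N" "\<forall>t\<in>#M'. pebbling_tree E t \<and> apex t = v"
      "\<forall>k\<in>#X. pebbling_tree E k \<and> apex k = x"
      "\<forall>z. (\<Sum>k\<in>#X. leaf_count k z) \<le> (\<Sum>t\<in>#N. leaf_count t z)"
        "\<forall>z. z \<noteq> y \<longrightarrow> (\<Sum>t\<in>#M'. leaf_count t z) = 0"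
      "2 * (\<Sum>t\<in>#M'. leaf_count t y) \<le> size X" using add.IH by blast
    have tt: "pebbling_tree E t" "apex t \<in> Q" "\<And>z. leaf_count t z \<le> D z" "size t \<le> n" and av:
      "apex t = v"
      using tr t M(2) by auto
    have "\<exists>t' X. pebbling_tree E t' \<and> apex t' = apex t \<and> (\<forall>k\<in>#X. pebbling_tree E k \<and> apex k = x)
      \<and> (\<forall>z. (\<Sum>k\<in>#X. leaf_count k z) \<le> leaf_count t z) \<and> (\<forall>z. z \<noteq> y \<longrightarrow> leaf_count t' z = 0)
      \<and> 2 * leaf_count t' y \<le> size X"
      by (rule cut_tree[OF leaf enter tt])
    then obtain t' Y where t': "pebbling_tree E t'" "apex t' = v"
      "\<forall>k\<in>#Y. pebbling_tree E k \<and> apex k = x"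
        "\<forall>z. (\<Sum>k\<in>#Y. leaf_count k z) \<le> leaf_count t z" "\<forall>z. z \<noteq> y \<longrightarrow> leaf_count t' z = 0"
          "2 * leaf_count t' y \<le> size Y"
      unfolding av by blast
    have "(\<Sum>k\<in>#X + Y. leaf_count k z) \<le> (\<Sum>t\<in>#add_mset t N. leaf_count t z)" for z
      using IH(4)[rule_format, of z] t'(4)[rule_format, of z] by simp
    then show ?case using IH t' by (intro exI[of _ "add_mset t' M'"] exI[of _ "X + Y"]) auto
  qed
  from this[of M] obtain M' X where *: "size M' = size M" "\<forall>t\<in>#M'. pebbling_tree E t \<and> apex t = v"
    "\<forall>k\<in>#X. pebbling_tree E k \<and> apex k = x"
      "\<forall>z. (\<Sum>k\<in>#X. leaf_count k z) \<le> (\<Sum>t\<in>#M. leaf_count t z)"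
        "\<forall>z. z \<noteq> y \<longrightarrow> (\<Sum>t\<in>#M'. leaf_count t z) = 0"
      "2 * (\<Sum>t\<in>#M'. leaf_count t y) \<le> size X" by auto
  have "forest E D x X" using *(3,4) M(1) unfolding forest_def by (meson le_trans)
  moreover have "(\<Sum>t\<in>#M'. leaf_count t z) \<le> (if z = y then size X div 2 else 0)" for z
    using *(5)[rule_format, of z] *(6) by (cases "z = y") auto
  then have "forest E (\<lambda>z. if z = y then size X div 2 else 0) v M'" using *(2)
    unfolding forest_def by blast
  ultimately show ?thesis using *(1) by blast
qed

lemma size_le_sum_mset:
  fixes f :: "'b \<Rightarrow> nat"
  shows "(\<And>t. t \<in># M \<Longrightarrow> 1 \<le> f t) \<Longrightarrow> size M \<le> (\<Sum>t\<in>#M. f t)"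
proof (induction M)
  case (add t M)
  from add.prems[of t] add.IH add.prems have "1 \<le> f t" "size M \<le> (\<Sum>t\<in>#M. f t)" by auto
  then show ?case by simp
qed simp

text \<open>With at most one pebble on each vertex of \<open>Q\<close>, the kids of a node cannot
  both be leaves on the same vertex of \<open>Q\<close>. So the descent inside \<open>Q\<close> ends
  at a move from outside, whose two subtrees form the required pair.\<close>

lemma tree_leaves_set:
  assumes "\<And>v. v \<in> Q \<Longrightarrow> D v \<le> 1"
  shows "pebbling_tree E t \<Longrightarrow> apex t \<in> Q \<Longrightarrow> (\<And>z. leaf_count t z \<le> D z) \<Longrightarrow> kids t \<noteq> {#} \<Longrightarrow>
     \<exists>q z M. q \<in> Q \<and> z \<notin> Q \<and> E z q \<and> forest E D z M \<and> size M = 2"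
proof (induction t)
  case (Node q l t')
  have lr: "leaf_count l z + leaf_count t' z \<le> D z" for z using Node.prems(3)[of z] by simp
  have le: "\<And>z. leaf_count l z \<le> D z" "\<And>z. leaf_count t' z \<le> D z" using lr
    by (meson add_leD1 add_leD2)+
  show ?case
  proof (cases "apex l \<in> Q")
    case True
    have "kids l \<noteq> {#} \<or> kids t' \<noteq> {#}"
    proof (rule ccontr)
      assume "\<not> ?thesis"
      then have "l = Leaf (apex l)" "t' = Leaf (apex l)" using Node.prems
        by (cases l; cases t'; auto)+
      then have "leaf_count l (apex l) = 1" "leaf_count t' (apex l) = 1"
        by (metis leaf_count.simps(1))+
      then show False using lr[of "apex l"] assms[OF True] by simp
    qed
    then show ?thesis using Node.IH Node.prems True le by auto
  next
    case False
    have "forest E D (apex l) {#l, t'#}" using Node.prems lr unfolding forest_def by simp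
    then show ?thesis using Node.prems False by (intro exI[of _ q] exI[of _ "apex l"] exI[of _
      "{#l, t'#}"]) auto
  qed
qed simp

text \<open>Going down from an apex in \<open>Q\<close>, the first subtree outside \<open>Q\<close>
  would belong to a pair that enters \<open>Q\<close> at a cost below \<open>n\<close>.\<close>

lemma leaf_count_within:
  assumes "\<And>q l t'. q \<in> Q \<Longrightarrow> E (apex l) q \<Longrightarrow> apex l \<notin> Q \<Longrightarrow> apex t' = apex l \<Longrightarrow> pebbling_tree E l
       \<Longrightarrow> pebbling_tree E t' \<Longrightarrow> (\<And>z. leaf_count l z + leaf_count t' z \<le> D z) \<Longrightarrow> size l
         + size t' < n \<Longrightarrow> False"
  shows "pebbling_tree E t \<Longrightarrow> apex t \<in> Q \<Longrightarrow> (\<And>z. leaf_count t z \<le> D z) \<Longrightarrow> size t \<le> n \<Longrightarrow> x \<notin> Q \<Longrightarrow>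
    leaf_count t x = 0"
proof (induction t)
  case (Node q l t')
  have lr: "leaf_count l z + leaf_count t' z \<le> D z" for z using Node.prems(3)[of z] by simp
  have le: "\<And>z. leaf_count l z \<le> D z" "\<And>z. leaf_count t' z \<le> D z" using lr
    by (meson add_leD1 add_leD2)+
  have "apex l \<in> Q"
  proof (rule ccontr)
    assume "apex l \<notin> Q"
    moreover have "q \<in> Q" "E (apex l) q" "apex t' = apex l" "pebbling_tree E l" "pebbling_tree E t'"
      "size l + size t' < n" using Node.prems by auto
    ultimately show False using assms[of q l t'] lr by blast
  qed
  moreover have "apex t' = apex l" "pebbling_tree E l" "pebbling_tree E t'" "size l \<le> n"
    "size t' \<le> n"
    using Node.prems by auto
  ultimately have "leaf_count l x = 0" "leaf_count t' x = 0"
    using Node.IH le Node.prems(5) by metis+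
  then show ?case by simp
qed auto

section \<open>Reach of a distribution\<close>

locale pebbling_graph =
  fixes V :: "'a set" and E :: "'a \<Rightarrow> 'a \<Rightarrow> bool"
  assumes simple: "simple_graph V E"
begin

lemma finite_V: "finite V" and E_V: "E u v \<Longrightarrow> u \<in> V \<and> v \<in> V"
  and E_sym: "E u v \<Longrightarrow> E v u" and E_irrefl: "\<not> E v v"
  using simple unfolding simple_graph_def by auto

lemma peb_moves_size:
  assumes "peb_moves E D Q" "is_dist V D"
  shows "is_dist V Q \<and> (\<Sum>x\<in>V. Q x) \<le> (\<Sum>x\<in>V. D x)"
  using assms
proof (induction rule: rtranclp_induct)
  case (step Q Q')
  then obtain u v where uv: "E u v" "2 \<le> Q u" "Q' = (Q(u := Q u - 2))(v := Q v + 1)"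
    unfolding peb_move_def by blast
  have V: "u \<in> V" "v \<in> V" "u \<noteq> v" using E_V[OF uv(1)] E_irrefl uv(1) by auto
  have "(\<Sum>x\<in>V. f x) = f u + f v + (\<Sum>x\<in>V - {u} - {v}. f x)" for f :: "'a \<Rightarrow> nat"
    using finite_V V by (simp add: sum.remove[of V u] sum.remove[of "V - {u}" v])
  note this[of Q] this[of Q']
  moreover have "(\<Sum>x\<in>V - {u} - {v}. Q' x) = (\<Sum>x\<in>V - {u} - {v}. Q x)"
    using uv(3) by (intro sum.cong) auto
  ultimately have "(\<Sum>x\<in>V. Q' x) \<le> (\<Sum>x\<in>V. Q x)" using uv V by auto
  moreover have "is_dist V Q'" using step uv V unfolding is_dist_def by auto
  ultimately show ?case using step by auto
qed auto

lemma k_reachable_bound: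
  assumes "is_dist V D" "k_reachable E D v k"
  shows "k \<le> (\<Sum>x\<in>V. D x)"
proof -
  obtain Q where Q: "peb_moves E D Q" "k \<le> Q v" using assms(2) unfolding k_reachable_def by blast
  have "is_dist V Q" "(\<Sum>x\<in>V. Q x) \<le> (\<Sum>x\<in>V. D x)" using peb_moves_size[OF Q(1) assms(1)] by auto
  moreover have "Q v \<le> (\<Sum>x\<in>V. Q x)"
    by (cases "v \<in> V") (use finite_V \<open>is_dist V Q\<close> in \<open>auto simp: is_dist_def intro: member_le_sum\<close>)
  ultimately show ?thesis using Q(2) by linarith
qed

lemma k_reachable_iff:
  assumes "is_dist V D"
  shows "k_reachable E D v k \<longleftrightarrow> k \<le> reach E D v"
proof -
  have "k_reachable E D v 0" unfolding k_reachable_def by auto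
  then have "k_reachable E D v (reach E D v)"
    unfolding reach_def using k_reachable_bound[OF assms, of v] by (metis GreatestI_nat)
  moreover have "k_reachable E D v k \<Longrightarrow> k \<le> reach E D v"
    unfolding reach_def using k_reachable_bound[OF assms, of v] by (metis Greatest_le_nat)
  ultimately show ?thesis by (meson k_reachable_mono order_refl)
qed

lemma reachable_iff: "is_dist V D \<Longrightarrow> reachable E D v \<longleftrightarrow> 1 \<le> reach E D v"
  unfolding reachable_def by (rule k_reachable_iff)

lemma exc_eq: "is_dist V D \<Longrightarrow> exc E D v = int (reach E D v - 1)"
  unfolding exc_def by (auto simp: reachable_iff)

lemma reach_initial: "is_dist V D \<Longrightarrow> D v \<le> reach E D v"
  using k_reachable_initial k_reachable_iff by metis

lemma reach_mono:
  assumes "is_dist V B" "\<And>x. A x \<le> B x"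
  shows "reach E A v \<le> reach E B v"
proof -
  have "is_dist V A" using assms unfolding is_dist_def by (metis le_zero_eq)
  then show ?thesis using k_reachable_iff[of A v] k_reachable_iff[OF assms(1), of v]
      k_reachable_mono[of E A v _ B] assms(2) by auto
qed

lemma reach_add:
  assumes "is_dist V A" "is_dist V B"
  shows "reach E A v + reach E B v \<le> reach E (\<lambda>x. A x + B x) v"
proof -
  have "is_dist V (\<lambda>x. A x + B x)" using assms unfolding is_dist_def by auto
  then show ?thesis
    using k_reachable_add[of E A v "reach E A v" B "reach E B v"] k_reachable_iff assms by auto
qed

lemma reach_nbr:
  assumes "is_dist V D" "E x v" "2 * j \<le> reach E D x"
  shows "j \<le> reach E D v"
proof -
  obtain Q where Q: "peb_moves E D Q" "2 * j \<le> Q x"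
    using assms k_reachable_iff unfolding k_reachable_def by blast
  have "x \<noteq> v" using assms(2) E_irrefl by auto
  then obtain Q' where "peb_moves E Q Q'" "j \<le> Q' v"
    using repeated_moves[of E x v j Q] assms(2) Q(2) by blast
  then have "k_reachable E D v j" using Q(1) unfolding k_reachable_def by (meson rtranclp_trans)
  then show ?thesis using k_reachable_iff assms(1) by blast
qed

lemma reach_zero: "reach E (\<lambda>_. 0) v = 0"
proof -
  have "is_dist V (\<lambda>_. 0)" unfolding is_dist_def by auto
  then show ?thesis using k_reachable_bound[of "\<lambda>_. 0" v "reach E (\<lambda>_. 0) v"] k_reachable_iff
    by auto
qed

lemma finite_support: "is_dist V D \<Longrightarrow> finite {x. D x > 0}"
  unfolding is_dist_def using finite_V by (metis
    (mono_tags, lifting) finite_subset gr_implies_not0 mem_Collect_eq subsetI)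

lemma forest_reach: "is_dist V D \<Longrightarrow> forest E D v M \<Longrightarrow> size M \<le> reach E D v"
  using forest_k_reachable E_irrefl k_reachable_iff by metis

lemma reach_forest: "is_dist V D \<Longrightarrow> k \<le> reach E D v \<Longrightarrow> \<exists>M. forest E D v M \<and> size M = k"
  using k_reachable_forest[OF finite_support] E_irrefl k_reachable_iff by metis

lemma is_dist_unit: "is_dist V D \<Longrightarrow> is_dist V (unit_at D w)"
  unfolding is_dist_def unit_at_def by auto

lemma single_pebble_reach:
  assumes "is_dist V D" "D k \<le> 1" "v \<noteq> k"
  shows "reach E (unit_at D k) v = 0"
proof -
  have "peb_moves E (unit_at D k) Q \<Longrightarrow> Q = unit_at D k" for Q
  proof (induction rule: rtranclp_induct)
    case (step Q R)
    then show ?case using assms(2) unfolding peb_move_def unit_at_def by (auto split: if_splits)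
  qed simp
  then have "k_reachable E (unit_at D k) v j \<Longrightarrow> j \<le> unit_at D k v" for j
    unfolding k_reachable_def by blast
  then show ?thesis using k_reachable_iff[OF is_dist_unit[OF assms(1)], of k v
    "reach E (unit_at D k) v"] assms(3)
    unfolding unit_at_def by fastforce
qed

lemma reach_ge: "forest E D v M \<Longrightarrow> is_dist V D \<Longrightarrow> b \<le> size M \<Longrightarrow> b \<le> reach E D v"
  using forest_reach le_trans by blast

lemma reach_relay:
  assumes "is_dist V D" "b \<le> reach E (\<lambda>z. if z = q then reach E D q else 0) v" "q \<in> V"
  shows "b \<le> reach E D v"
proof -
  let ?A = "\<lambda>z. if z = q then reach E D q else 0"
  obtain Q where Q: "peb_moves E D Q" "reach E D q \<le> Q q"
    using k_reachable_iff[OF assms(1), of q "reach E D q"] unfolding k_reachable_def by blast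
  have "is_dist V ?A" using assms(3) unfolding is_dist_def by auto
  then have "k_reachable E ?A v b" using assms(2) k_reachable_iff by blast
  then have "k_reachable E Q v b" by (rule k_reachable_mono) (use Q(2) in auto)
  then show ?thesis using k_reachable_trans[OF Q(1)] k_reachable_iff[OF assms(1)] by blast
qed

section \<open>Weights and the reach of a single unit\<close>

definition walk :: "nat \<Rightarrow> 'a \<Rightarrow> 'a \<Rightarrow> bool" where "walk n = E ^^ n"

definition distance :: "'a \<Rightarrow> 'a \<Rightarrow> nat" where "distance x v = (LEAST n. walk n x v)"

text \<open>The usual potential: a pebble loses half its worth with every step of distance from
  \<open>v\<close>, so no move increases the total. Vertices without a walk to \<open>v\<close> are
  treated apart because \<open>LEAST\<close> is arbitrary there.\<close>

definition weight :: "'a \<Rightarrow> 'a \<Rightarrow> real" where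
  "weight v x = (if \<exists>n. walk n x v then (1/2) ^ distance x v else 0)"

lemma weight_edge:
  assumes "E x y"
  shows "weight v y \<le> 2 * weight v x"
proof (cases "\<exists>n. walk n y v")
  case True
  then have w: "walk (distance y v) y v" unfolding distance_def by (rule LeastI_ex)
  then have w': "walk (Suc (distance y v)) x v" using assms unfolding walk_def
    by (meson relpowp_Suc_I2)
  then have "distance x v \<le> Suc (distance y v)" unfolding distance_def[of x] by (rule Least_le)
  then have "(1/2::real) ^ Suc (distance y v) \<le> (1/2) ^ distance x v"
    by (intro power_decreasing) auto
  moreover have "weight v y = (1/2) ^ distance y v" "weight v x = (1/2) ^ distance x v"
    using True w' unfolding weight_def by auto
  ultimately show ?thesis by simp
next
  case False
  then show ?thesis unfolding weight_def by auto
qed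

lemma peb_moves_weight:
  assumes "peb_moves E D Q"
  shows "(\<Sum>x\<in>V. Q x * weight v x) \<le> (\<Sum>x\<in>V. D x * weight v x)"
  using assms
proof (induction rule: rtranclp_induct)
  case (step Q Q')
  then obtain a b where uv: "E a b" "2 \<le> Q a" "Q' = (Q(a := Q a - 2))(b := Q b + 1)"
    unfolding peb_move_def by blast
  have V: "a \<in> V" "b \<in> V" "a \<noteq> b" using E_V[OF uv(1)] E_irrefl uv(1) by auto
  have "(\<Sum>x\<in>V. f x) = f a + f b + (\<Sum>x\<in>V - {a} - {b}. f x)" for f :: "'a \<Rightarrow> real"
    using finite_V V by (simp add: sum.remove[of V a] sum.remove[of "V - {a}" b])
  note this[of "\<lambda>x. Q x * weight v x"] this[of "\<lambda>x. Q' x * weight v x"]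
  moreover have "(\<Sum>x\<in>V - {a} - {b}. Q' x * weight v x) = (\<Sum>x\<in>V - {a} - {b}. Q x * weight v x)"
    using uv(3) by (intro sum.cong) auto
  moreover have "Q' a * weight v a + Q' b * weight v b \<le> Q a * weight v a + Q b * weight v b"
    using uv(2,3) V(3) weight_edge[OF uv(1), of v] by (simp add: algebra_simps of_nat_diff)
  ultimately show ?case using step.IH by linarith
qed simp

text \<open>A pebble on \<open>v\<close> weighs 1, and all pebbles of the unit start with the weight
  of \<open>k\<close>; so the walk in the conclusion can be a shortest one.\<close>

lemma unit_reach_bound:
  assumes "is_dist V D" "1 \<le> reach E (unit_at D k) v"
  shows "\<exists>n. walk n k v \<and> 2 ^ n * reach E (unit_at D k) v \<le> D k"
proof -
  let ?U = "unit_at D k" and ?r = "reach E (unit_at D k) v"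
  have dU: "is_dist V ?U" by (rule is_dist_unit[OF assms(1)])
  then obtain Q where Q: "peb_moves E ?U Q" "?r \<le> Q v"
    using k_reachable_iff[of ?U v ?r] unfolding k_reachable_def by blast
  have "is_dist V Q" using peb_moves_size[OF Q(1) dU] by blast
  then have v: "v \<in> V" using Q(2) assms(2) unfolding is_dist_def by fastforce
  have "k \<in> V"
  proof (rule ccontr)
    assume "k \<notin> V"
    then have "?U = (\<lambda>_. 0)" using assms(1) unfolding unit_at_def is_dist_def by auto
    then show False using reach_zero assms(2) by simp
  qed
  have w0: "walk 0 v v" unfolding walk_def by simp
  then have "distance v v = 0" unfolding distance_def by simp
  then have wv: "weight v v = 1" unfolding weight_def using w0 by auto
  have "real ?r \<le> Q v * weight v v" using wv Q(2) by simp
  also have "\<dots> \<le> (\<Sum>x\<in>V. Q x * weight v x)"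
    using finite_V v by (intro member_le_sum) (auto simp: weight_def)
  also have "\<dots> \<le> (\<Sum>x\<in>V. ?U x * weight v x)" by (rule peb_moves_weight[OF Q(1)])
  also have "\<dots> = (\<Sum>x\<in>V. if x = k then D k * weight v k else 0)"
    unfolding unit_at_def by (intro sum.cong) auto
  also have "\<dots> = D k * weight v k" using finite_V \<open>k \<in> V\<close> by simp
  finally have le: "real ?r \<le> D k * weight v k" .
  then have ex: "\<exists>n. walk n k v" using assms(2) unfolding weight_def by (auto split: if_splits)
  then have "real ?r \<le> D k * (1/2) ^ distance k v" using le unfolding weight_def by simp
  then have "2 ^ distance k v * real ?r \<le> D k" by (simp add: field_simps)
  then have "real (2 ^ distance k v * ?r) \<le> real (D k)" by simp
  then have "2 ^ distance k v * ?r \<le> D k" by (simp only: of_nat_le_iff)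
  moreover have "walk (distance k v) k v" unfolding distance_def using ex by (rule LeastI_ex)
  ultimately show ?thesis by blast
qed

lemma walk_reach:
  assumes "is_dist V D" "walk n k x" "2 ^ n * j \<le> reach E D k"
  shows "j \<le> reach E D x"
  using assms(2,3)
proof (induction n arbitrary: x j)
  case 0
  then show ?case unfolding walk_def by simp
next
  case (Suc n)
  then obtain y where y: "walk n k y" "E y x" unfolding walk_def by auto
  have "2 ^ n * (2 * j) \<le> reach E D k" using Suc.prems(2)
    by (simp add: mult.assoc mult.left_commute)
  then have "2 * j \<le> reach E D y" using Suc.IH y(1) by blast
  then show ?case using reach_nbr[OF assms(1) y(2)] by blast
qed

text \<open>By the weight bound the reach at \<open>v\<close> is attained by marching along one
  shortest walk from \<open>k\<close>, and the vertex before \<open>v\<close> on it gets at least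
  twice as many pebbles. With several occupied vertices the pebbles might have to arrive from
  several neighbours.\<close>

lemma unit_reach_step:
  assumes "is_dist V D" "1 \<le> reach E (unit_at D k) v" "v \<noteq> k"
  shows "\<exists>x. E x v \<and> 2 * reach E (unit_at D k) v \<le> reach E (unit_at D k) x"
proof -
  let ?U = "unit_at D k" and ?r = "reach E (unit_at D k) v"
  have dU: "is_dist V ?U" by (rule is_dist_unit[OF assms(1)])
  obtain n where n: "walk n k v" "2 ^ n * ?r \<le> D k" using unit_reach_bound[OF assms(1,2)] by blast
  then obtain m where m: "n = Suc m" using assms(3) unfolding walk_def by (cases n) auto
  then obtain x where x: "walk m k x" "E x v" using n(1) unfolding walk_def by auto
  have "D k \<le> reach E ?U k" using reach_initial[OF dU, of k] unfolding unit_at_def by simp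
  then have "2 ^ m * (2 * ?r) \<le> reach E ?U k" using n(2) m
    by (simp add: mult.assoc mult.left_commute)
  then show ?thesis using walk_reach[OF dU x(1)] x(2) by blast
qed

end

section \<open>The boosted vertices\<close>

text \<open>Here \<open>d\<close> stands for \<Delta> - 2, so \<open>d_pos\<close> is the assumption
  \<Delta> \<ge> 3.\<close>

locale solvable_pebbling = pebbling_graph V E
  for V :: "'a set" and E :: "'a \<Rightarrow> 'a \<Rightarrow> bool" +
  fixes P :: "'a dist" and d :: nat
  assumes dist: "is_dist V P" and solvable: "solvable V E P"
    and degree_le: "v \<in> V \<Longrightarrow> card {u. E v u} \<le> d + 2" and d_pos: "1 \<le> d"
begin

definition occupied :: "'a set" where "occupied = {v \<in> V. P v > 0}"

definition unit_reach :: "'a \<Rightarrow> 'a \<Rightarrow> nat" where "unit_reach k v = reach E (unit_at P k) v"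

definition total_reach :: "'a \<Rightarrow> nat" where "total_reach v = reach E P v"

definition cover_count :: "'a \<Rightarrow> nat" where "cover_count v = card {k \<in> occupied. 1 \<le> unit_reach k v}"

text \<open>The truncated difference \<open>unit_reach k v - 1\<close> is the excess of the unit at \<open>k\<close>, also where
this unit does not reach \<open>v\<close>.\<close>
definition surplus :: "'a \<Rightarrow> int" where
  "surplus v = int (total_reach v) - 1 - (\<Sum>k\<in>occupied. int (unit_reach k v - 1))"

definition uncovered :: "'a set" where "uncovered = {v \<in> V. cover_count v = 0}"

definition rich :: "'a set" where "rich = {v \<in> V. \<exists>k\<in>occupied. 2 \<le> unit_reach k v}"

definition boosted :: "'a set" where "boosted = {v \<in> V. 2 \<le> total_reach v} - rich"

definition nbrs :: "'a \<Rightarrow> 'a set" where "nbrs v = {u. E v u}"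

lemma finite_occupied: "finite occupied" unfolding occupied_def using finite_V by auto

lemma nbrs_V: "nbrs v \<subseteq> V" unfolding nbrs_def using E_V by auto

lemma finite_nbrs: "finite (nbrs v)" using nbrs_V finite_V finite_subset by blast

lemma card_nbrs: "v \<in> V \<Longrightarrow> card (nbrs v) \<le> d + 2" unfolding nbrs_def by (rule degree_le)

lemma total_reach_pos: "v \<in> V \<Longrightarrow> 1 \<le> total_reach v"
  using solvable reachable_iff[OF dist] unfolding solvable_def total_reach_def by auto

lemma dist_unit: "is_dist V (unit_at P k)" by (rule is_dist_unit[OF dist])

lemma unit_reach_to: "E x v \<Longrightarrow> 2 * j \<le> unit_reach k x \<Longrightarrow> j \<le> unit_reach k v"
  unfolding unit_reach_def using reach_nbr[OF dist_unit] by blast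

lemma unit_reach_from: "1 \<le> unit_reach k v \<Longrightarrow> v \<noteq> k \<Longrightarrow> \<exists>x. E x v \<and> 2 * unit_reach k v
  \<le> unit_reach k x"
  unfolding unit_reach_def by (rule unit_reach_step[OF dist])

lemma unit_reach_self: "P k \<le> unit_reach k k"
  using reach_initial[OF dist_unit, of k k] unfolding unit_reach_def unit_at_def by simp

lemma unit_reach_self_pos: "k \<in> occupied \<Longrightarrow> 1 \<le> unit_reach k k"
  using unit_reach_self[of k] unfolding occupied_def by auto

lemma sum_unit_reach_le:
  assumes "K \<subseteq> occupied"
  shows "(\<Sum>k\<in>K. unit_reach k v) \<le> reach E (\<lambda>x. \<Sum>k\<in>K. unit_at P k x) v"
proof -
  have "finite K" using assms finite_occupied finite_subset by blast
  then show ?thesis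
  proof (induction K)
    case (insert k K)
    have "is_dist V (\<lambda>x. \<Sum>k\<in>K. unit_at P k x)"
      using dist_unit unfolding is_dist_def by (auto intro: sum.neutral)
    from reach_add[OF dist_unit this, of k v] insert show ?case by (simp add: unit_reach_def)
  qed simp
qed

lemma sum_unit_reach_le_total: "(\<Sum>k\<in>occupied. unit_reach k v) \<le> total_reach v"
proof -
  have "(\<Sum>k\<in>occupied. unit_at P k x) \<le> P x" for x
    unfolding unit_at_def using finite_occupied by simp
  then have "reach E (\<lambda>x. \<Sum>k\<in>occupied. unit_at P k x) v \<le> total_reach v"
    unfolding total_reach_def by (rule reach_mono[OF dist])
  then show ?thesis using sum_unit_reach_le[of occupied v] by simp
qed

lemma sum_unit_exc: "(\<Sum>k\<in>occupied. int (unit_reach k v - 1))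
  = (\<Sum>k\<in>occupied. int (unit_reach k v)) - int (cover_count v)"
proof -
  have "(\<Sum>k\<in>occupied. int (unit_reach k v - 1)) = (\<Sum>k\<in>occupied. int (unit_reach k v) - (if 1
    \<le> unit_reach k v then 1 else 0))"
    by (intro sum.cong) auto
  also have "\<dots> = (\<Sum>k\<in>occupied. int (unit_reach k v)) - (\<Sum>k\<in>occupied. if 1
    \<le> unit_reach k v then 1 else 0)"
    by (rule sum_subtractf)
  also have "(\<Sum>k\<in>occupied. if 1 \<le> unit_reach k v then 1 else 0) = int (cover_count v)"
    unfolding cover_count_def using finite_occupied by (simp add: sum.If_cases Int_def)
  finally show ?thesis .
qed

text \<open>What the units bring to \<open>v\<close> separately can be brought jointly. Passing from
  reach to excess costs 1 for each unit that covers \<open>v\<close>, but only 1 for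
  \<open>P\<close>.\<close>

lemma surplus_ge: "int (cover_count v) - 1 \<le> surplus v"
  using sum_unit_reach_le_total[of v] unfolding surplus_def sum_unit_exc
    by (simp add: of_nat_sum[symmetric] del: of_nat_sum)

lemma surplus_nonneg: "v \<in> V \<Longrightarrow> 0 \<le> surplus v"
proof (cases "cover_count v = 0")
  case True
  assume "v \<in> V"
  then have "unit_reach k v = 0" if "k \<in> occupied" for k
    using True finite_occupied that unfolding cover_count_def by auto
  then show ?thesis using total_reach_pos[OF \<open>v \<in> V\<close>] unfolding surplus_def by simp
qed (use surplus_ge[of v] in auto)

lemma cover_count_ge1: "k \<in> occupied \<Longrightarrow> 1 \<le> unit_reach k v \<Longrightarrow> 1 \<le> cover_count v"
  unfolding cover_count_def using finite_occupied by (auto simp: Suc_le_eq card_gt_0_iff)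

lemma cover_count_ge2:
  assumes "k \<in> occupied" "j \<in> occupied" "k \<noteq> j" "1 \<le> unit_reach k v" "1 \<le> unit_reach j v"
  shows "2 \<le> cover_count v"
proof -
  have "card {k, j} \<le> cover_count v" unfolding cover_count_def using finite_occupied assms
    by (intro card_mono) auto
  then show ?thesis using assms(3) by simp
qed

lemma surplus_single:
  assumes "k \<in> occupied" "1 \<le> unit_reach k v" "\<And>j. j \<in> occupied \<Longrightarrow> j \<noteq> k \<Longrightarrow> unit_reach j v \<le> 1"
  shows "surplus v = int (total_reach v) - int (unit_reach k v)"
proof -
  have "(\<Sum>j\<in>occupied. int (unit_reach j v - 1)) = int (unit_reach k v - 1)
    + (\<Sum>j\<in>occupied - {k}. int (unit_reach j v - 1))"
    using finite_occupied assms(1) by (simp add: sum.remove)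
  also have "(\<Sum>j\<in>occupied - {k}. int (unit_reach j v - 1)) = 0" using assms(3)
    by (intro sum.neutral) auto
  finally show ?thesis unfolding surplus_def using assms(2) by simp
qed

lemma boosted_unit_reach: "v \<in> boosted \<Longrightarrow> k \<in> occupied \<Longrightarrow> unit_reach k v \<le> 1"
  unfolding boosted_def rich_def by force

lemma surplus_boosted: "v \<in> boosted \<Longrightarrow> surplus v = int (total_reach v) - 1"
  using boosted_unit_reach[of v] unfolding surplus_def by simp

lemma boosted_V: "boosted \<subseteq> V" and rich_V: "rich \<subseteq> V" and uncovered_V: "uncovered \<subseteq> V"
  and boosted_rich: "boosted \<inter> rich = {}"
  unfolding boosted_def rich_def uncovered_def by auto

lemma finite_boosted: "finite boosted" and finite_rich: "finite rich" and finite_uncovered: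
  "finite uncovered"
  using boosted_V rich_V uncovered_V finite_V finite_subset by blast+

lemma surplus_boosted_ge1: "v \<in> boosted \<Longrightarrow> 1 \<le> surplus v"
  using surplus_boosted[of v] unfolding boosted_def by auto

lemma P_boosted: "v \<in> boosted \<Longrightarrow> P v \<le> 1"
  using unit_reach_self[of v] boosted_unit_reach[of v v] boosted_V unfolding occupied_def
    by (cases "P v = 0") auto

lemma cover_count_nbr_rich: "b \<in> rich \<Longrightarrow> E b v \<Longrightarrow> 1 \<le> cover_count v"
  unfolding rich_def using unit_reach_to[of b v 1] cover_count_ge1 by auto

lemma uncovered_nbr_not_rich: "v \<in> uncovered \<Longrightarrow> E b v \<Longrightarrow> b \<notin> rich"
  using cover_count_nbr_rich[of b v] unfolding uncovered_def by auto

lemma uncovered_P: "v \<in> uncovered \<Longrightarrow> P v = 0"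
  using unit_reach_self_pos[of v] cover_count_ge1[of v v] unfolding uncovered_def occupied_def
    by (cases "P v = 0") auto

lemma uncovered_rich: "uncovered \<inter> rich = {}"
proof -
  have False if "v \<in> uncovered" "v \<in> rich" for v
  proof -
    obtain k where "k \<in> occupied" "2 \<le> unit_reach k v" using \<open>v \<in> rich\<close> unfolding rich_def by auto
    then have "1 \<le> cover_count v" using cover_count_ge1[of k v] by linarith
    then show False using \<open>v \<in> uncovered\<close> unfolding uncovered_def by auto
  qed
  then show ?thesis by blast
qed

lemma boosted_or_rich: "v \<in> V \<Longrightarrow> 2 \<le> total_reach v \<Longrightarrow> v \<in> boosted \<or> v \<in> rich"
  unfolding boosted_def by auto

section \<open>Cheapest pairs of pebbles and their suppliers\<close>

definition cheapest :: "'a \<Rightarrow> 'a ptree multiset" where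
  "cheapest u = arg_min cost (\<lambda>M. forest E P u M \<and> size M = 2)"

definition min_cost :: "'a \<Rightarrow> nat" where "min_cost u = cost (cheapest u)"

text \<open>The vertices from which the last moves of the fixed cheapest pair are made; a leaf in
  the pair contributes none.\<close>

definition suppliers :: "'a \<Rightarrow> 'a set" where "suppliers u = apex ` set_mset (all_kids (cheapest u))"

lemma forest_total_reach: "forest E P v M \<Longrightarrow> size M \<le> total_reach v"
  unfolding total_reach_def by (rule forest_reach[OF dist])

lemma cheapest_forest:
  assumes "2 \<le> total_reach u"
  shows "forest E P u (cheapest u)" "size (cheapest u) = 2"
proof -
  obtain M where "forest E P u M \<and> size M = 2"
    using assms reach_forest[OF dist, of 2 u] unfolding total_reach_def by blast
  from arg_min_nat_lemma[of "\<lambda>M. forest E P u M \<and> size M = 2", OF this, of cost]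
  show "forest E P u (cheapest u)" "size (cheapest u) = 2" unfolding cheapest_def by auto
qed

lemma min_cost_le: "forest E P u M \<Longrightarrow> size M = 2 \<Longrightarrow> min_cost u \<le> cost M"
  unfolding min_cost_def cheapest_def by (intro arg_min_nat_le) auto

lemma kid_apex:
  assumes "forest E P v M" "x \<in> apex ` set_mset (all_kids M)"
  shows "E x v" "2 \<le> total_reach x" "min_cost x < cost M"
proof -
  obtain k where k: "k \<in># all_kids M" "x = apex k" using assms(2) by auto
  from kid_pair[OF assms(1) k(1)] obtain l t where
    lt: "E x v" "forest E P x {#l, t#}" "cost {#l, t#} < cost M" using k(2) by auto
  then show "E x v" "2 \<le> total_reach x" "min_cost x < cost M"
    using forest_total_reach[OF lt(2)] min_cost_le[OF lt(2)] by auto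
qed

lemma suppliers_props:
  assumes "2 \<le> total_reach u" "x \<in> suppliers u"
  shows "E x u" "2 \<le> total_reach x" "min_cost x < min_cost u"
  using kid_apex[OF cheapest_forest(1)[OF assms(1)], of x] assms(2)
    unfolding suppliers_def min_cost_def by auto

definition boosted_suppliers :: "'a \<Rightarrow> 'a set" where "boosted_suppliers u = suppliers u \<inter> boosted"

definition rich_nbrs :: "'a \<Rightarrow> 'a set" where "rich_nbrs u = nbrs u \<inter> rich"

lemma suppliers_subset: "2 \<le> total_reach u \<Longrightarrow> suppliers u \<subseteq> boosted_suppliers u \<union> rich_nbrs u"
  using suppliers_props E_V E_sym boosted_or_rich
    unfolding boosted_suppliers_def rich_nbrs_def nbrs_def by blast

lemma boosted_total_reach: "u \<in> boosted \<Longrightarrow> 2 \<le> total_reach u" unfolding boosted_def by auto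

text \<open>A boosted vertex carries at most one pebble, as its own unit would otherwise make it
  rich; so one tree of its pair ends in a move.\<close>

lemma suppliers_nonempty: "u \<in> boosted \<Longrightarrow> suppliers u \<noteq> {}"
  using forest_has_kid[OF cheapest_forest(1)[OF boosted_total_reach[of u]]] cheapest_forest(2)[OF
    boosted_total_reach[of u]] P_boosted[of u]
  unfolding suppliers_def by fastforce

lemma finite_boosted_suppliers: "finite (boosted_suppliers u)" and finite_rich_nbrs:
  "finite (rich_nbrs u)"
  unfolding boosted_suppliers_def rich_nbrs_def using finite_boosted finite_nbrs by auto

text \<open>The pebble that reaches \<open>v\<close> comes by a move from a vertex of total reach at
  least 2. A rich one is excluded, because the unit that makes it rich would cover
  \<open>v\<close>.\<close>

lemma supplier_in_boosted:
  assumes "v \<in> uncovered - boosted"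
  shows "\<exists>u\<in>boosted. v \<in> nbrs u"
proof -
  have v: "v \<in> uncovered" "v \<in> V" using assms uncovered_V by auto
  obtain M where M: "forest E P v M" "size M = 1"
    using total_reach_pos[OF v(2)] reach_forest[OF dist, of 1 v] unfolding total_reach_def by blast
  then obtain k where "k \<in># all_kids M" using forest_has_kid[OF M(1)] uncovered_P[OF v(1)] by auto
  then have "E (apex k) v" "2 \<le> total_reach (apex k)" using kid_apex[OF M(1)] by auto
  then show ?thesis using boosted_or_rich uncovered_nbr_not_rich[OF v(1)] E_V unfolding nbrs_def
    by blast
qed

text \<open>Among the at most d + 2 neighbours of a boosted vertex, three disjoint kinds are
  counted: uncovered ones outside \<open>boosted\<close>, boosted ones and rich ones. The first kind
  exhausts \<open>uncovered - boosted\<close>; a supply between boosted vertices appears in the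
  second kind at both ends, whence the factor 2. The indicator on the right adds the uncovered
  vertices that are boosted themselves.\<close>

lemma card_uncovered_le:
  "int (card uncovered) + (\<Sum>u\<in>boosted. 2 * int (card (boosted_suppliers u))
    + int (card (rich_nbrs u)))
     \<le> (\<Sum>u\<in>boosted. int d + 2 + (if u \<in> uncovered then 1 else 0))"
proof -
  have "uncovered - boosted \<subseteq> (\<Union>u\<in>boosted. nbrs u \<inter> (uncovered - boosted))"
    using supplier_in_boosted by blast
  then have "card (uncovered - boosted) \<le> card (\<Union>u\<in>boosted. nbrs u \<inter> (uncovered - boosted))"
    using finite_boosted finite_nbrs by (intro card_mono) auto
  also have "\<dots> \<le> (\<Sum>u\<in>boosted. card (nbrs u \<inter> (uncovered - boosted)))"
    by (rule card_UN_le[OF finite_boosted])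
  finally have 1: "card (uncovered - boosted) \<le> (\<Sum>u\<in>boosted. card (nbrs u \<inter>
    (uncovered - boosted)))" .
  have 2: "card (nbrs u \<inter> (uncovered - boosted)) + card (nbrs u \<inter> boosted) + card (rich_nbrs u)
    \<le> d + 2" if "u \<in> boosted" for u
  proof -
    have "card (nbrs u \<inter> (uncovered - boosted)) + card (nbrs u \<inter> boosted) + card (rich_nbrs u)
        = card ((nbrs u \<inter> (uncovered - boosted)) \<union> (nbrs u \<inter> boosted) \<union> rich_nbrs u)"
      using finite_nbrs[of u] boosted_rich uncovered_rich unfolding rich_nbrs_def
      by (subst card_Un_disjoint, auto)+
    also have "\<dots> \<le> card (nbrs u)" using finite_nbrs unfolding rich_nbrs_def
      by (intro card_mono) auto
    finally show ?thesis using card_nbrs[of u] that boosted_V by fastforce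
  qed
  let ?X = "SIGMA u:boosted. boosted_suppliers u" and ?Y = "SIGMA u:boosted. nbrs u \<inter> boosted"
  \<comment> \<open>\<open>min_cost\<close> decreases towards suppliers, so an edge is used as a supply in one direction only.\<close>
  have suppliers_D: "x \<in> boosted" "E x u" "min_cost x < min_cost u" if "u \<in> boosted"
    "x \<in> boosted_suppliers u" for x u
    using that suppliers_props[of u x] boosted_total_reach unfolding boosted_suppliers_def by auto
  have X: "?X \<union> ?X\<inverse> \<subseteq> ?Y" using suppliers_D E_sym unfolding nbrs_def by auto
  have "x \<notin> boosted_suppliers u" if "u \<in> boosted" "x \<in> boosted" "u \<in> boosted_suppliers x" for x u
    using suppliers_D(3)[of u x] suppliers_D(3)[of x u] that by auto
  then have X2: "?X \<inter> ?X\<inverse> = {}" by blast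
  have "2 * card ?X = card ?X + card (?X\<inverse>)" by (simp add: card_inverse)
  also have "\<dots> = card (?X \<union> ?X\<inverse>)" using X2 finite_boosted finite_boosted_suppliers
    by (subst card_Un_disjoint) auto
  also have "\<dots> \<le> card ?Y" using X finite_boosted finite_nbrs by (intro card_mono) auto
  finally have 3: "2 * (\<Sum>u\<in>boosted. card (boosted_suppliers u))
    \<le> (\<Sum>u\<in>boosted. card (nbrs u \<inter> boosted))"
    using finite_boosted finite_boosted_suppliers finite_nbrs by (simp add: card_SigmaI)
  have "(\<Sum>u\<in>boosted. card (nbrs u \<inter> (uncovered - boosted)) + card (nbrs u \<inter> boosted)
    + card (rich_nbrs u)) \<le> (\<Sum>u\<in>boosted. d + 2)"
    by (intro sum_mono 2)
  then have "card (uncovered - boosted) + 2 * (\<Sum>u\<in>boosted. card (boosted_suppliers u))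
    + (\<Sum>u\<in>boosted. card (rich_nbrs u)) \<le> (\<Sum>u\<in>boosted. d + 2)"
    using 1 3 by (simp only: sum.distrib)
  moreover have "card uncovered = card (uncovered - boosted)
    + (\<Sum>u\<in>boosted. if u \<in> uncovered then 1 else 0)"
    using finite_boosted finite_uncovered card_Int_Diff[of uncovered boosted]
      by (simp add: sum.If_cases Int_def conj_commute)
  ultimately have "card uncovered + (\<Sum>u\<in>boosted. 2 * card (boosted_suppliers u)
    + card (rich_nbrs u)) \<le> (\<Sum>u\<in>boosted. d + 2 + (if u \<in> uncovered then 1 else 0))"
    by (simp only: sum.distrib sum_distrib_left[symmetric])
  then have "int (card uncovered + (\<Sum>u\<in>boosted. 2 * card (boosted_suppliers u)
    + card (rich_nbrs u))) \<le> int (\<Sum>u\<in>boosted. d + 2 + (if u \<in> uncovered then 1 else 0))"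
    by (simp only: of_nat_le_iff)
  moreover have "int (\<Sum>u\<in>boosted. d + 2 + (if u \<in> uncovered then 1 else 0)) = (\<Sum>u\<in>boosted. int d
    + 2 + (if u \<in> uncovered then 1 else 0))"
    unfolding of_nat_sum by (intro sum.cong) auto
  ultimately show ?thesis by simp
qed

section \<open>Uncovered boosted vertices with one boosted supplier\<close>

definition single_fed :: "'a set" where
  "single_fed = {u \<in> boosted. u \<in> uncovered \<and> card (boosted_suppliers u) = 1}"

text \<open>At a vertex of \<open>single_fed\<close> the supply saves two edges, but the vertex is
  itself uncovered, so its budget may be short by 1. This debt is passed on to the supplier.\<close>

definition dependents :: "'a \<Rightarrow> 'a set" where
  "dependents w = {y \<in> single_fed. boosted_suppliers y = {w}}"

lemma finite_dependents: "finite (dependents w)"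
  unfolding dependents_def single_fed_def using finite_boosted by auto

lemma sum_card_dependents: "(\<Sum>w\<in>boosted. card (dependents w)) = card single_fed"
proof -
  have "single_fed = (\<Union>w\<in>boosted. dependents w)"
  proof
    show "single_fed \<subseteq> (\<Union>w\<in>boosted. dependents w)"
    proof
      fix u assume u: "u \<in> single_fed"
      then obtain w where "boosted_suppliers u = {w}" unfolding single_fed_def
        by (auto simp: card_1_singleton_iff)
      then show "u \<in> (\<Union>w\<in>boosted. dependents w)" using u
        unfolding dependents_def boosted_suppliers_def by auto
    qed
  qed (auto simp: dependents_def)
  moreover have "card (\<Union>w\<in>boosted. dependents w) = (\<Sum>w\<in>boosted. card (dependents w))"
    using finite_boosted finite_dependents by (intro card_UN_disjoint) (auto simp: dependents_def)
  ultimately show ?thesis by simp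
qed

text \<open>Being uncovered, \<open>y\<close> has neither pebbles nor rich neighbours. So both trees
  of its cheapest pair are nodes, and all four kids sit on \<open>w\<close>.\<close>

lemma dependents_forest:
  assumes "y \<in> dependents w"
  shows "forest E P w (all_kids (cheapest y))" "4 \<le> size (all_kids (cheapest y))" "E w y"
    "4 \<le> total_reach w"
proof -
  have y: "y \<in> boosted" "y \<in> uncovered" "boosted_suppliers y = {w}" using assms
    unfolding dependents_def single_fed_def by auto
  note o = cheapest_forest[OF boosted_total_reach[OF y(1)]]
  have "rich_nbrs y = {}" using uncovered_nbr_not_rich[OF y(2)] E_sym
    unfolding rich_nbrs_def nbrs_def by blast
  then have sub: "suppliers y \<subseteq> {w}" using suppliers_subset[OF boosted_total_reach[OF y(1)]] y(3)
    by auto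
  then show f: "forest E P w (all_kids (cheapest y))"
    using o(1) unfolding suppliers_def by (intro forest_all_kids) auto
  show sz: "4 \<le> size (all_kids (cheapest y))" using size_all_kids[OF o(1)] o(2) uncovered_P[OF
    y(2)] by simp
  show "4 \<le> total_reach w" using forest_total_reach[OF f] sz by simp
  show "E w y" using y suppliers_props boosted_total_reach unfolding boosted_suppliers_def by blast
qed

text \<open>For the dependent \<open>y\<close> with the cheapest pair, whatever feeds
  \<open>w\<close> within that pair is cheaper still and hence not a dependent.\<close>

lemma cheapest_dependent_forest:
  assumes "dependents w \<noteq> {}"
  shows "\<exists>M. forest E P w M \<and> 4 \<le> size M \<and> apex ` set_mset (all_kids M) \<inter> dependents w = {}"
proof -
  obtain y where y: "y \<in> dependents w" "\<And>x. x \<in> dependents w \<Longrightarrow> min_cost y \<le> min_cost x"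
    using assms finite_dependents ex_min_if_finite[of "min_cost ` dependents w"]
    by (metis (no_types, lifting) arg_min_if_finite(1,2) not_le)
  let ?M = "all_kids (cheapest y)"
  have "min_cost x < min_cost y" if "x \<in> apex ` set_mset (all_kids ?M)" for x
    using kid_apex(3)[OF dependents_forest(1)[OF y(1)] that] cost_all_kids[of "cheapest y"]
      unfolding min_cost_def by linarith
  then show ?thesis using dependents_forest[OF y(1)] y(2) by (meson disjoint_iff leD)
qed

lemma dependents_nbrs: "dependents w \<subseteq> nbrs w"
  using dependents_forest(3) unfolding nbrs_def by auto

text \<open>Collecting four pebbles gives \<open>w\<close> a surplus of at least 3, so the right
  side is at least 2d \<ge> d + 1; and at least one of its at most d + 2 neighbours feeds it without
  being a dependent.\<close>

lemma card_dependents_bound: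
  assumes "w \<in> boosted"
  shows "int (card (dependents w)) \<le> int d * (surplus w - 1)"
proof (cases "dependents w = {}")
  case True
  then show ?thesis using surplus_boosted_ge1[OF assms] by simp
next
  case False
  then have surplus: "surplus w \<ge> 3" using surplus_boosted[OF assms] dependents_forest(4) by force
  obtain M where M: "forest E P w M" "4 \<le> size M" "apex ` set_mset (all_kids M) \<inter> dependents w = {}"
    using cheapest_dependent_forest[OF False] by blast
  obtain k where k: "k \<in># all_kids M" using forest_has_kid[OF M(1)] P_boosted[OF assms] M(2)
    by force
  then have "E (apex k) w" "apex k \<notin> dependents w" using kid_apex(1)[OF M(1)] M(3) by auto
  then have "dependents w \<subseteq> nbrs w - {apex k}" "apex k \<in> nbrs w" using dependents_nbrs E_sym
    unfolding nbrs_def by auto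
  then have "card (dependents w) \<le> card (nbrs w) - 1" using finite_nbrs
    by (metis card_Diff_singleton card_mono finite_Diff)
  then have "int (card (dependents w)) \<le> int d + 1" using card_nbrs[of w] assms boosted_V by force
  also have "\<dots> \<le> int d * 2" using d_pos by simp
  also have "\<dots> \<le> int d * (surplus w - 1)" using surplus by (intro mult_left_mono) auto
  finally show ?thesis .
qed

text \<open>The extra 1 helps to pay for components charged to \<open>w\<close>. Four trees on
  \<open>w\<close>, at most one of them a leaf, have at least six kids, more than the five pebbles
  \<open>q\<close> can collect. So a feeding neighbour other than \<open>q\<close> exists, and two
  neighbours of \<open>w\<close> are not dependents.\<close>

lemma card_dependents_bound_strict:
  assumes "w \<in> boosted" "2 \<le> surplus w" "E w q" "q \<notin> dependents w" "total_reach q \<le> 5"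
  shows "int (card (dependents w)) + 1 \<le> int d * (surplus w - 1)"
proof (cases "dependents w = {}")
  case True
  have "int d * 1 \<le> int d * (surplus w - 1)" using assms(2) by (intro mult_left_mono) auto
  then show ?thesis using True d_pos by (simp only: card.empty)
next
  case False
  then have surplus: "surplus w \<ge> 3" using surplus_boosted[OF assms(1)] dependents_forest(4)
    by force
  obtain M where M: "forest E P w M" "4 \<le> size M" "apex ` set_mset (all_kids M) \<inter> dependents w = {}"
    using cheapest_dependent_forest[OF False] by blast
  have sz: "6 \<le> size (all_kids M)" using size_all_kids[OF M(1)] P_boosted[OF assms(1)] M(2) by auto
  obtain k where k: "k \<in># all_kids M" "apex k \<noteq> q"
  proof (rule ccontr)
    assume "\<not> thesis"
    then have "forest E P q (all_kids M)" using that by (intro forest_all_kids[OF M(1)]) auto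
    then show False using forest_total_reach[of q] sz assms(5) by fastforce
  qed
  then have "E (apex k) w" "apex k \<notin> dependents w" using kid_apex(1)[OF M(1)] M(3) by auto
  then have "dependents w \<subseteq> nbrs w - {apex k, q}" "{apex k, q} \<subseteq> nbrs w"
    using dependents_nbrs E_sym assms(3,4) unfolding nbrs_def by auto
  then have "card (dependents w) \<le> card (nbrs w) - card {apex k, q}" using finite_nbrs
    by (metis card_Diff_subset card_mono finite.emptyI finite.insertI finite_Diff)
  then have "int (card (dependents w)) + 1 \<le> int d + 1"
    using card_nbrs[of w] assms(1) boosted_V k(2) by force
  also have "\<dots> \<le> int d * 2" using d_pos by simp
  also have "\<dots> \<le> int d * (surplus w - 1)" using surplus by (intro mult_left_mono) auto
  finally show ?thesis .
qed

section \<open>The balance at a boosted vertex\<close>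

definition weak_roots :: "'a set" where
  "weak_roots = {u \<in> boosted. boosted_suppliers u = {} \<and> card (rich_nbrs u) = 1 \<and> cover_count u
    = 1}"

text \<open>Here \<open>a\<close> will be the number of components charged to \<open>u\<close>. The
  bound on dependents absorbs them together with one \<open>d\<close>, so the constant 2 remains to
  be covered by saved edges and by multiple covering. A debt of 1 stays only in
  \<open>single_fed\<close> and in \<open>weak_roots\<close>, where one rich neighbour saves a
  single edge and no second unit covers \<open>u\<close>.\<close>

lemma boosted_local_bound:
  fixes a :: int
  assumes "u \<in> boosted" "a = 0 \<or> (a \<le> int (cover_count u) \<and> a \<le> int (card (rich_nbrs u))
    \<and> int (card (dependents u)) + 1 \<le> int d * (surplus u - 1))"
    and "0 \<le> a"
  shows "int d + 2 - 2 * int (card (boosted_suppliers u)) - int (card (rich_nbrs u))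
    + (if u \<in> uncovered then 1 else 0) + int (card (dependents u)) + a
    \<le> int d * surplus u + int (cover_count u - 1) + (if u \<in> weak_roots then 1 else 0)
      + (if u \<in> single_fed then 1 else 0)"
proof -
  have dp: "int (card (dependents u)) \<le> int d * surplus u - int d"
    using card_dependents_bound[OF assms(1)] by (simp add: algebra_simps)
  have a: "a = 0 \<or> (a \<le> int (cover_count u) \<and> a \<le> int (card (rich_nbrs u))
    \<and> int (card (dependents u)) + 1 \<le> int d * surplus u - int d)"
    using assms(2) by (simp add: algebra_simps)
  have ne: "boosted_suppliers u \<union> rich_nbrs u \<noteq> {}"
    using suppliers_subset[OF boosted_total_reach] suppliers_nonempty assms(1) by blast
  have rich_nbrs: "card (rich_nbrs u) = 0 \<longleftrightarrow> rich_nbrs u = {}" and boosted_suppliers: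
    "card (boosted_suppliers u) = 0 \<longleftrightarrow> boosted_suppliers u = {}"
    using finite_rich_nbrs finite_boosted_suppliers by auto
  have m_rich: "1 \<le> cover_count u" if "rich_nbrs u \<noteq> {}"
    using cover_count_nbr_rich[of _ u] E_sym that unfolding rich_nbrs_def nbrs_def by blast
  show ?thesis
  proof (cases "u \<in> uncovered")
    case True
    then have "cover_count u = 0" unfolding uncovered_def by auto
    then have "rich_nbrs u = {}" "a = 0" using m_rich a assms(3) by auto
    then have "card (boosted_suppliers u) \<ge> 1" "boosted_suppliers u \<noteq> {}"
      using ne boosted_suppliers by auto
    show ?thesis
    proof (cases "card (boosted_suppliers u) = 1")
      case True
      then have "u \<in> single_fed" "u \<notin> weak_roots"
        using assms(1) \<open>u \<in> uncovered\<close> \<open>boosted_suppliers u \<noteq> {}\<close>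
          unfolding single_fed_def weak_roots_def by auto
      then show ?thesis using \<open>u \<in> uncovered\<close> \<open>cover_count u = 0\<close> \<open>rich_nbrs u = {}\<close> \<open>a
        = 0\<close> dp True by simp
    next
      case False
      then have "u \<notin> single_fed" "u \<notin> weak_roots" using \<open>boosted_suppliers u \<noteq> {}\<close>
        unfolding single_fed_def weak_roots_def by auto
      then show ?thesis using \<open>u \<in> uncovered\<close> \<open>cover_count u = 0\<close> \<open>rich_nbrs u = {}\<close> \<open>a
        = 0\<close> dp False \<open>card (boosted_suppliers u) \<ge> 1\<close> by simp
    qed
  next
    case False
    then have m1: "1 \<le> cover_count u" using assms(1) boosted_V unfolding uncovered_def by auto
    have "u \<notin> single_fed" using False unfolding single_fed_def by auto
    show ?thesis
    proof (cases "boosted_suppliers u = {}")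
      case True
      then have "1 \<le> card (rich_nbrs u)" using ne rich_nbrs by auto
      show ?thesis
      proof (cases "u \<in> weak_roots")
        case True
        then have "cover_count u = 1" "card (rich_nbrs u) = 1" unfolding weak_roots_def by auto
        then show ?thesis using \<open>u \<notin> uncovered\<close> \<open>u \<notin> single_fed\<close> True a dp \<open>boosted_suppliers u
          = {}\<close> by auto
      next
        case False
        then have "cover_count u \<noteq> 1 \<or> card (rich_nbrs u) \<noteq> 1" using True assms(1)
          unfolding weak_roots_def by auto
        then show ?thesis using \<open>u \<notin> uncovered\<close> \<open>u \<notin> single_fed\<close> False True a dp m1 \<open>1
          \<le> card (rich_nbrs u)\<close> by auto
      qed
    next
      case False
      then have "1 \<le> card (boosted_suppliers u)" "u \<notin> weak_roots" using boosted_suppliers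
        unfolding weak_roots_def by auto
      then show ?thesis using \<open>u \<notin> uncovered\<close> \<open>u \<notin> single_fed\<close> a dp m1 by auto
    qed
  qed
qed

section \<open>Components of rich vertices\<close>

definition rich_surplus :: "'a set" where "rich_surplus = {v \<in> rich. 1 \<le> surplus v}"

text \<open>Connectivity is expressed by cuts: every proper nonempty part of \<open>Q\<close> has an edge to the rest.\<close>
definition component :: "'a set \<Rightarrow> bool" where
  "component Q \<longleftrightarrow> Q \<subseteq> rich_surplus \<and> Q \<noteq> {} \<and> (\<forall>x\<in>Q. \<forall>y\<in>rich_surplus. E x y \<longrightarrow> y \<in> Q)
     \<and> (\<forall>A. A \<subseteq> Q \<longrightarrow> A \<noteq> {} \<longrightarrow> A \<noteq> Q \<longrightarrow> (\<exists>a\<in>A. \<exists>b\<in>Q - A. E a b))"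

definition attached_roots :: "'a set \<Rightarrow> 'a set" where
  "attached_roots Q = {u \<in> weak_roots. \<exists>q\<in>Q. E u q}"

text \<open>By the tree bound on the edges of a component \<open>Q\<close>, a total gain of 2 lets \<open>Q\<close> pay for all weak
roots attached to it.\<close>
definition gain :: "'a set \<Rightarrow> 'a \<Rightarrow> int" where
  "gain Q q = int d * (surplus q - 1) + int (cover_count q - 1)
    + int (card (nbrs q - Q - weak_roots))"

lemma rich_surplus_rich: "rich_surplus \<subseteq> rich" unfolding rich_surplus_def by auto

lemma componentD:
  assumes "component Q"
  shows "Q \<subseteq> rich_surplus" "Q \<noteq> {}" "\<And>x y. x \<in> Q \<Longrightarrow> y \<in> rich_surplus \<Longrightarrow> E x y \<Longrightarrow> y \<in> Q"
    "\<And>A. A \<subseteq> Q \<Longrightarrow> A \<noteq> {} \<Longrightarrow> A \<noteq> Q \<Longrightarrow> \<exists>a\<in>A. \<exists>b\<in>Q - A. E a b"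
  using assms unfolding component_def by blast+

lemma component_finite: "component Q \<Longrightarrow> finite Q"
  using componentD(1) rich_surplus_rich finite_rich by (meson finite_subset)

text \<open>If the intersection were a proper part of \<open>Q\<close>, the edge leaving it inside
  \<open>Q\<close> would end in \<open>rich_surplus\<close> and therefore in \<open>Q'\<close>
  too.\<close>

lemma component_disjoint:
  assumes "component Q" "component Q'" "Q \<inter> Q' \<noteq> {}"
  shows "Q = Q'"
proof -
  have "Q \<inter> Q' = Q" if "component Q" "component Q'" "Q \<inter> Q' \<noteq> {}" for Q Q'
    using componentD(4)[OF that(1), of "Q \<inter> Q'"] componentD(3)[OF that(2)] componentD(1)[OF
      that(1)] that(3) by blast
  from this[OF assms] this[OF assms(2,1)] assms(3) show ?thesis by blast
qed

lemma component_exists: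
  assumes "x \<in> rich_surplus"
  shows "\<exists>Q. component Q \<and> x \<in> Q"
proof -
  define R where "R = (\<lambda>a b. E a b \<and> a \<in> rich_surplus \<and> b \<in> rich_surplus)"
  define Q where "Q = {y. R\<^sup>*\<^sup>* x y}"
  have "symp R" unfolding R_def symp_def using E_sym by blast
  then have sym: "R\<^sup>*\<^sup>* a b \<Longrightarrow> R\<^sup>*\<^sup>* b a" for a b by (meson symp_rtranclp sympD)
  have "y \<in> rich_surplus" if "R\<^sup>*\<^sup>* x y" for y
    using that by (induction) (auto simp: R_def assms)
  then have sub: "Q \<subseteq> rich_surplus" unfolding Q_def by auto
  have closed: "y \<in> Q" if "a \<in> Q" "y \<in> rich_surplus" "E a y" for a y
  proof -
    have "R a y" using that sub unfolding R_def by auto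
    then show ?thesis using that(1) unfolding Q_def by auto
  qed
  have "\<exists>a\<in>A. \<exists>b\<in>Q - A. E a b" if A: "A \<subseteq> Q" "A \<noteq> {}" "A \<noteq> Q" for A
  proof (rule ccontr)
    assume no: "\<not> ?thesis"
    obtain a y where ay: "a \<in> A" "y \<in> Q" "y \<notin> A" using A by blast
    then have "R\<^sup>*\<^sup>* x a" "R\<^sup>*\<^sup>* x y" using A(1) unfolding Q_def by auto
    then have "R\<^sup>*\<^sup>* a y" using sym by (meson rtranclp_trans)
    then have "y \<in> A"
    proof (induction)
      case (step y z)
      then have "E y z" "z \<in> Q" using closed[of y z] A(1) unfolding R_def by auto
      then show ?case using no step.IH by blast
    qed (rule ay(1))
    then show False using ay by simp
  qed
  then have "component Q" unfolding component_def using sub closed Q_def by blast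
  then show ?thesis unfolding Q_def by blast
qed

text \<open>Grow a connected part from one vertex: the cut condition joins each new vertex to the
  part built so far, and that edge adds 2 to the degree sum.\<close>

lemma component_edges:
  assumes "component Q"
  shows "2 * card Q \<le> (\<Sum>q\<in>Q. card (nbrs q \<inter> Q)) + 2"
proof -
  have fin: "finite Q" by (rule component_finite[OF assms])
  have "n < card Q \<Longrightarrow> \<exists>A\<subseteq>Q. card A = Suc n \<and> 2 * Suc n \<le> (\<Sum>q\<in>A. card (nbrs q \<inter> A)) + 2" for n
  proof (induction n)
    case 0
    obtain q where "q \<in> Q" using componentD(2)[OF assms] by blast
    then show ?case by (intro exI[of _ "{q}"]) auto
  next
    case (Suc n)
    then obtain A where A: "A \<subseteq> Q" "card A = Suc n" "2 * Suc n \<le> (\<Sum>q\<in>A. card (nbrs q \<inter> A)) + 2"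
      by auto
    have finA: "finite A" using A(1) fin finite_subset by blast
    have "A \<noteq> {}" "A \<noteq> Q" using A(2) Suc.prems by auto
    then obtain a b where ab: "a \<in> A" "b \<in> Q - A" "E a b" using componentD(4)[OF assms A(1)]
      by blast
    let ?A = "insert b A"
    have le: "card (nbrs q \<inter> A) \<le> card (nbrs q \<inter> ?A)" for q
      using finA by (intro card_mono) auto
    have "card (insert b (nbrs a \<inter> A)) \<le> card (nbrs a \<inter> ?A)"
      using finA ab unfolding nbrs_def by (intro card_mono) auto
    then have a: "Suc (card (nbrs a \<inter> A)) \<le> card (nbrs a \<inter> ?A)" using ab(2) finA by simp
    have "card {a} \<le> card (nbrs b \<inter> ?A)"
      using finA ab E_sym unfolding nbrs_def by (intro card_mono) auto
    then have b: "1 \<le> card (nbrs b \<inter> ?A)" by simp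
    have "(\<Sum>q\<in>A - {a}. card (nbrs q \<inter> A)) \<le> (\<Sum>q\<in>A - {a}. card (nbrs q \<inter> ?A))"
      by (intro sum_mono le)
    then have "(\<Sum>q\<in>A. card (nbrs q \<inter> A)) + 1 \<le> (\<Sum>q\<in>A. card (nbrs q \<inter> ?A))"
      using a finA ab(1) by (simp add: sum.remove[of A a])
    then have "(\<Sum>q\<in>A. card (nbrs q \<inter> A)) + 2 \<le> (\<Sum>q\<in>?A. card (nbrs q \<inter> ?A))"
      using b finA ab(2) by simp
    then show ?case using A ab finA by (intro exI[of _ ?A]) auto
  qed
  moreover have "0 < card Q" using fin componentD(2)[OF assms] by (simp add: card_gt_0_iff)
  ultimately obtain A where "A \<subseteq> Q" "card A = card Q" "2 * card Q \<le> (\<Sum>q\<in>A. card (nbrs q \<inter> A)) + 2"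
    by (metis Suc_pred lessI)
  then show ?thesis using fin card_subset_eq by metis
qed

text \<open>A weak root carries no pebble: its own unit would be the only one covering it, and a
  single pebble cannot bring two to the neighbour \<open>w\<close>. So all four kids of its cheapest
  pair sit on \<open>w\<close>. The unit \<open>i\<close> brings at most three there, since four
  would give \<open>u\<close> two, and any other unit at most one, since two would cover
  \<open>u\<close>; hence \<open>w\<close> has surplus.\<close>

lemma weak_rootE:
  assumes "u \<in> weak_roots"
  obtains w i where "rich_nbrs u = {w}" "w \<in> rich_surplus" "i \<in> occupied" "2 \<le> unit_reach i w"
    "E w u"
    "forest E P w (all_kids (cheapest u))" "4 \<le> size (all_kids (cheapest u))"
    "\<And>k. k \<in> occupied \<Longrightarrow> 1 \<le> unit_reach k u \<Longrightarrow> k = i"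
proof -
  have u: "u \<in> boosted" "boosted_suppliers u = {}" "card (rich_nbrs u) = 1" "cover_count u = 1"
    using assms unfolding weak_roots_def by auto
  then obtain w where w: "rich_nbrs u = {w}" by (auto simp: card_1_singleton_iff)
  then have wB: "w \<in> rich" "E w u" using E_sym unfolding rich_nbrs_def nbrs_def by auto
  then obtain i where i: "i \<in> occupied" "2 \<le> unit_reach i w" unfolding rich_def by auto
  have "1 \<le> unit_reach i u" using unit_reach_to[of w u 1 i] wB i by simp
  then have uniq: "k = i" if "k \<in> occupied" "1 \<le> unit_reach k u" for k
    using cover_count_ge2[of k i u] that i(1) u(4) by auto
  have Pu: "P u = 0"
  proof (rule ccontr)
    assume "P u \<noteq> 0"
    then have "u \<in> occupied" using u(1) boosted_V unfolding occupied_def by auto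
    then have "u = i" using uniq unit_reach_self_pos by blast
    moreover have "w \<noteq> u" using wB E_irrefl by auto
    ultimately have "unit_reach i w = 0" using single_pebble_reach[OF dist, of u w] P_boosted[OF
      u(1)] unfolding unit_reach_def by simp
    then show False using i by simp
  qed
  note o = cheapest_forest[OF boosted_total_reach[OF u(1)]]
  have "suppliers u \<subseteq> {w}" using suppliers_subset[OF boosted_total_reach[OF u(1)]] u(2) w by auto
  then have f: "forest E P w (all_kids (cheapest u))"
    using o(1) unfolding suppliers_def by (intro forest_all_kids) auto
  have sz: "4 \<le> size (all_kids (cheapest u))" using size_all_kids[OF o(1)] o(2) Pu by simp
  have "unit_reach k w \<le> 1" if "k \<in> occupied" "k \<noteq> i" for k
    using unit_reach_to[of w u 1 k] wB uniq[of k] that by (cases "2 \<le> unit_reach k w") auto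
  then have "surplus w = int (total_reach w) - int (unit_reach i w)"
    using surplus_single[of i w] i by simp
  moreover have "unit_reach i w \<le> 3"
    using unit_reach_to[of w u 2 i] wB boosted_unit_reach[OF u(1) i(1)] by (cases
      "4 \<le> unit_reach i w") auto
  moreover have "4 \<le> total_reach w" using forest_total_reach[OF f] sz by simp
  ultimately have "w \<in> rich_surplus" unfolding rich_surplus_def using wB by auto
  then show thesis using that w i wB f sz uniq by blast
qed

lemma weak_roots_boosted: "weak_roots \<subseteq> boosted" unfolding weak_roots_def by auto

lemma finite_attached_roots: "finite (attached_roots Q)"
  unfolding attached_roots_def using weak_roots_boosted finite_boosted by (simp add: finite_subset)

text \<open>By the tree bound the edges inside \<open>Q\<close> leave at most \<open>d\<close> per
  vertex plus 2 in all for attached roots and other neighbours. The gain collects the budget beyond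
  \<open>d\<close> per vertex and the edges to those other neighbours.\<close>

lemma card_attached_roots_gain:
  assumes "component Q"
  shows "int (card (attached_roots Q)) \<le> (\<Sum>q\<in>Q. int d * surplus q + int (cover_count q - 1))
    + 2 - (\<Sum>q\<in>Q. gain Q q)"
proof -
  have fin: "finite Q" by (rule component_finite[OF assms])
  have QB: "Q \<subseteq> rich" using componentD(1)[OF assms] rich_surplus_rich by auto
  have "attached_roots Q \<subseteq> (\<Union>q\<in>Q. nbrs q \<inter> attached_roots Q)"
    unfolding attached_roots_def nbrs_def using E_sym by blast
  then have "card (attached_roots Q) \<le> card (\<Union>q\<in>Q. nbrs q \<inter> attached_roots Q)"
    using fin finite_nbrs by (intro card_mono) auto
  also have "\<dots> \<le> (\<Sum>q\<in>Q. card (nbrs q \<inter> attached_roots Q))" by (rule card_UN_le[OF fin])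
  finally have 1: "card (attached_roots Q) \<le> (\<Sum>q\<in>Q. card (nbrs q \<inter> attached_roots Q))" .
  have 2: "card (nbrs q \<inter> Q) + card (nbrs q \<inter> attached_roots Q) + card (nbrs q - Q - weak_roots)
    \<le> d + 2" if "q \<in> Q" for q
  proof -
    have "attached_roots Q \<inter> Q = {}" using weak_roots_boosted boosted_rich QB
      unfolding attached_roots_def by blast
    then have "card (nbrs q \<inter> Q) + card (nbrs q \<inter> attached_roots Q) + card (nbrs q - Q - weak_roots)
        = card ((nbrs q \<inter> Q) \<union> (nbrs q \<inter> attached_roots Q) \<union> (nbrs q - Q - weak_roots))"
      using finite_nbrs[of q] unfolding attached_roots_def by (subst card_Un_disjoint, auto)+
    also have "\<dots> \<le> card (nbrs q)" using finite_nbrs by (intro card_mono) auto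
    finally show ?thesis using card_nbrs[of q] that QB rich_V by fastforce
  qed
  have "(\<Sum>q\<in>Q. card (nbrs q \<inter> Q) + card (nbrs q \<inter> attached_roots Q)
    + card (nbrs q - Q - weak_roots)) \<le> (\<Sum>q\<in>Q. d + 2)"
    by (intro sum_mono 2)
  then have "2 * card Q + card (attached_roots Q) + (\<Sum>q\<in>Q. card (nbrs q - Q - weak_roots))
    \<le> card Q * (d + 2) + 2"
    using 1 component_edges[OF assms] by (simp add: sum.distrib)
  then have "int (2 * card Q + card (attached_roots Q) + (\<Sum>q\<in>Q. card (nbrs q - Q - weak_roots)))
    \<le> int (card Q * (d + 2) + 2)"
    by (simp only: of_nat_le_iff)
  then have "int (card (attached_roots Q)) \<le> int (card Q) * int d
    + 2 - (\<Sum>q\<in>Q. int (card (nbrs q - Q - weak_roots)))"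
    by (simp add: algebra_simps)
  also have "\<dots> = (\<Sum>q\<in>Q. int d * surplus q + int (cover_count q - 1)) + 2 - (\<Sum>q\<in>Q. gain Q q)"
    unfolding gain_def by (simp add: sum.distrib algebra_simps sum_subtractf)
  finally show ?thesis .
qed

lemma gain_parts:
  assumes "component Q" "q \<in> Q"
  shows "int d * (surplus q - 1) + int (cover_count q - 1) + int (card (nbrs q - Q - weak_roots))
    = gain Q q"
    "surplus q - 1 \<le> int d * (surplus q - 1)" "1 \<le> surplus q" "1 \<le> cover_count q"
proof -
  have q: "q \<in> rich" "1 \<le> surplus q" using componentD(1)[OF assms(1)] assms(2)
    unfolding rich_surplus_def by auto
  then show "1 \<le> surplus q" by simp
  obtain k where "k \<in> occupied" "2 \<le> unit_reach k q" using q(1) unfolding rich_def by auto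
  then show "1 \<le> cover_count q" using cover_count_ge1[of k q] by simp
  have "1 * (surplus q - 1) \<le> int d * (surplus q - 1)" using q(2) d_pos
    by (intro mult_right_mono) auto
  then show "surplus q - 1 \<le> int d * (surplus q - 1)" by simp
qed (simp add: gain_def)

lemma gain_nonneg: "component Q \<Longrightarrow> q \<in> Q \<Longrightarrow> 0 \<le> gain Q q"
  using gain_parts[of Q q] by linarith

text \<open>A pair cheaper than that of every attached root does not sit on an attached root, so the
  edge by which it enters \<open>Q\<close> is one that \<open>gain\<close> counts.\<close>

lemma enter_from:
  assumes Q: "component Q" and u: "\<And>u'. u' \<in> attached_roots Q \<Longrightarrow> n \<le> min_cost u'"
    and q: "q \<in> Q" "E (apex l) q" "apex l \<notin> Q" "apex t' = apex l" "pebbling_tree E l"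
      "pebbling_tree E t'"
    and D: "\<And>z. leaf_count l z + leaf_count t' z \<le> P z" "size l + size t' < n"
  shows "apex l \<in> nbrs q - Q - weak_roots"
proof -
  have "forest E P (apex l) {#l, t'#}" using q D(1) unfolding forest_def by simp
  then have "min_cost (apex l) < n" using min_cost_le[of "apex l" "{#l, t'#}"] D(2)
    unfolding cost_def by simp
  then have "apex l \<notin> attached_roots Q" using u by (meson leD)
  then have "apex l \<notin> weak_roots" using q(1,2) unfolding attached_roots_def by blast
  then show ?thesis using q E_sym unfolding nbrs_def by blast
qed

text \<open>Both \<open>q\<close> and \<open>i\<close> lie in \<open>Q\<close>, so that distinct
  components charged to the same \<open>z\<close> use distinct rich neighbours and distinct covering
  units. The bound 5 is the one needed in \<open>card_dependents_bound_strict\<close>.\<close>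

definition charges :: "'a set \<Rightarrow> 'a \<Rightarrow> bool" where
  "charges Q z \<longleftrightarrow> z \<in> boosted \<and> 2 \<le> surplus z \<and> (\<exists>q\<in>Q. E z q \<and> total_reach q \<le> 5)
    \<and> (\<exists>i\<in>Q. i \<in> occupied \<and> 1 \<le> unit_reach i z)"

text \<open>A gain of at most 1 rules out two sources of gain, which leaves one unit
  \<open>i\<close> that brings two pebbles to any vertex of \<open>Q\<close>. An attached root
  demands four pebbles on \<open>w\<close>, where \<open>i\<close> alone brings at most three; the
  missing help has to enter \<open>Q\<close>.\<close>

lemma component_gain:
  assumes Q: "component Q" and ne: "attached_roots Q \<noteq> {}"
    and small: "(\<Sum>q\<in>Q. gain Q q) \<le> 1"
  shows "1 \<le> (\<Sum>q\<in>Q. gain Q q) \<and> (\<exists>z. charges Q z)"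
proof -
  note fin = component_finite[OF Q] and QBY = componentD(1)[OF Q]
  have QB: "Q \<subseteq> rich" using QBY rich_surplus_rich by auto
  note nonneg = gain_nonneg[OF Q]
  have G1: "gain Q a \<le> 1" if "a \<in> Q" for a
    using member_le_sum[of a Q "gain Q"] that fin nonneg small by auto
  have G2: "gain Q a + gain Q b \<le> 1" if "a \<in> Q" "b \<in> Q" "a \<noteq> b" for a b
  proof -
    have "sum (gain Q) {a, b} \<le> sum (gain Q) Q" using that fin nonneg by (intro sum_mono2) auto
    then show ?thesis using that(3) small by simp
  qed
  have gm: "1 \<le> gain Q q" if "q \<in> Q" "2 \<le> cover_count q" for q
    using gain_parts[OF Q that(1)] that(2) by linarith
  have ext_card: "1 \<le> card (nbrs q - Q - weak_roots)" if "x \<in> nbrs q - Q - weak_roots" for x q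
    using that finite_nbrs[of q] by (metis card_0_eq empty_iff finite_Diff less_one not_le)
  have gx: "1 \<le> gain Q q" if "q \<in> Q" "x \<in> nbrs q - Q - weak_roots" for x q
    using gain_parts[OF Q that(1)] ext_card[OF that(2)] by linarith
  have gmx: "\<not> (2 \<le> cover_count q \<and> x \<in> nbrs q - Q - weak_roots)" if "q \<in> Q" for x q
    using gain_parts[OF Q that(1)] ext_card[of x q] G1[OF that] by force
  have extB: "x \<in> nbrs q - Q - weak_roots" if "q \<in> Q" "E x q" "x \<notin> Q" "x \<in> rich" for x q
    using that boosted_rich weak_roots_boosted E_sym unfolding nbrs_def by blast
  have "finite (attached_roots Q)" by (rule finite_attached_roots)
  \<comment> \<open>The choice of the cheapest root ensures that no pair entering \<open>Q\<close>
    within the forest on \<open>w\<close> sits on an attached root.\<close>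
  then obtain u where u: "u \<in> attached_roots Q"
    "\<And>u'. u' \<in> attached_roots Q \<Longrightarrow> min_cost u \<le> min_cost u'"
    using ne by (metis (no_types, lifting) arg_min_if_finite(1,2) not_le)
  then have uBR: "u \<in> weak_roots" unfolding attached_roots_def by auto
  then have uS: "u \<in> boosted" using weak_roots_boosted by auto
  obtain w i where w: "rich_nbrs u = {w}" "w \<in> rich_surplus" "i \<in> occupied" "2 \<le> unit_reach i w"
    "E w u"
    and M: "forest E P w (all_kids (cheapest u))" "4 \<le> size (all_kids (cheapest u))"
    using weak_rootE[OF uBR] by metis
  obtain q' where "q' \<in> Q" "E u q'" using u(1) unfolding attached_roots_def by auto
  then have "q' \<in> rich_nbrs u" using QB unfolding rich_nbrs_def nbrs_def by auto
  then have wQ: "w \<in> Q" using w(1) \<open>q' \<in> Q\<close> by auto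
  have riw: "unit_reach i w < 4" using unit_reach_to[of w u 2 i] w(5) boosted_unit_reach[OF uS
    w(3)] by (cases "4 \<le> unit_reach i w") auto
  \<comment> \<open>Otherwise some edge of \<open>Q\<close> joins a vertex that gets two pebbles
    from \<open>i\<close> to one that gets two only from other units; both ends are then covered
    twice, a gain of 2.\<close>
  have ri: "2 \<le> unit_reach i q" if "q \<in> Q" for q
  proof (rule ccontr)
    assume "\<not> ?thesis"
    then have "{q \<in> Q. 2 \<le> unit_reach i q} \<noteq> Q" "{q \<in> Q. 2 \<le> unit_reach i q} \<noteq> {}"
      using that wQ w(4) by auto
    then obtain a b where ab: "a \<in> Q" "2 \<le> unit_reach i a" "b \<in> Q" "\<not> 2 \<le> unit_reach i b" "E a b"
      using componentD(4)[OF Q, of "{q \<in> Q. 2 \<le> unit_reach i q}"] by blast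
    obtain k where k: "k \<in> occupied" "2 \<le> unit_reach k b" using ab(3) QB unfolding rich_def by auto
    have "k \<noteq> i" using k ab by auto
    moreover have "1 \<le> unit_reach k a" "1 \<le> unit_reach i b"
      using unit_reach_to[of b a 1 k] unit_reach_to[of a b 1 i] ab E_sym k by auto
    ultimately have "2 \<le> cover_count a" "2 \<le> cover_count b"
      using cover_count_ge2[of k i] k w(3) ab(2) by auto
    moreover have "a \<noteq> b" using ab by auto
    ultimately show False using G2[OF ab(1,3)] gm[OF ab(1)] gm[OF ab(3)] by linarith
  qed
  \<comment> \<open>A second such unit would cover \<open>q\<close> and a neighbour in
    \<open>Q\<close> twice. If \<open>q\<close> is alone, one of the two units lies elsewhere and
    enters from a rich vertex outside \<open>Q\<close>, a further edge on top of the double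
    cover.\<close>
  have uniq: "unit_reach k q \<le> 1" if kq: "k \<in> occupied" "k \<noteq> i" "q \<in> Q" for k q
  proof (rule ccontr)
    assume "\<not> ?thesis"
    then have k: "2 \<le> unit_reach k q" by simp
    then have mq: "2 \<le> cover_count q" using cover_count_ge2[of k i q] kq(1,2) w(3) ri[OF kq(3)]
      by auto
    show False
    proof (cases "Q = {q}")
      case False
      then obtain b where b: "b \<in> Q" "E q b" "b \<noteq> q" using componentD(4)[OF Q, of "{q}"] kq(3)
        by blast
      have "1 \<le> unit_reach k b" using unit_reach_to[OF b(2), of 1 k] k by simp
      then have "2 \<le> cover_count b" using cover_count_ge2[of k i b] kq(1,2) w(3) ri[OF b(1)] by auto
      then show False using G2[OF kq(3) b(1)] gm[OF b(1)] gm[OF kq(3) mq] b(3)[symmetric]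
        by linarith
    next
      case True
      obtain j where j: "j \<in> occupied" "j \<noteq> q" "2 \<le> unit_reach j q"
        using kq(1,2) k w(3) ri[OF kq(3)] by (cases "i = q") auto
      then obtain x where x: "E x q" "2 * unit_reach j q \<le> unit_reach j x"
        using unit_reach_from[of j q] by auto
      then have "x \<in> rich" using j E_V unfolding rich_def by force
      moreover have "x \<notin> Q" using True x(1) E_irrefl by auto
      ultimately show False using gmx[OF kq(3)] mq extB[OF kq(3) x(1)] by blast
    qed
  qed
  have cQ: "surplus q = int (total_reach q) - int (unit_reach i q)" if "q \<in> Q" for q
    using surplus_single[of i q] w(3) ri[OF that] uniq that by simp
  have occ: "2 \<le> cover_count k" if "k \<in> occupied" "k \<in> Q" "k \<noteq> i" for k
    using cover_count_ge2[of k i k] that w(3) ri[OF that(2)] unit_reach_self_pos by auto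
  let ?M = "all_kids (cheapest u)"
  have costM: "cost ?M \<le> min_cost u" unfolding min_cost_def by (rule cost_all_kids)
  have enter: "apex l \<in> nbrs q - Q - weak_roots"
    if "q \<in> Q" "E (apex l) q" "apex l \<notin> Q" "apex t = apex l" "pebbling_tree E l" "pebbling_tree E t"
      "\<And>z. leaf_count l z + leaf_count t z \<le> P z" "size l + size t < min_cost u" for q l t
    using enter_from[OF Q u(2) that] .
  have QV: "q \<in> V" if "q \<in> Q" for q using that QB rich_V by auto
  have iQ: "i \<in> Q"
  proof (rule ccontr)
    assume iQ: "i \<notin> Q"
    \<comment> \<open>The unit at \<open>i\<close> enters \<open>Q\<close> by an edge from some \<open>x\<close> to \<open>y\<close>; since the total gain is at most 1, all else
      that feeds \<open>w\<close> passes through this edge too, and the unit alone could bring four pebbles to \<open>w\<close>.\<close>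
    have "Max (unit_reach i ` Q) \<in> unit_reach i ` Q" using fin wQ by (intro Max_in) auto
    then obtain y where y: "y \<in> Q" "unit_reach i y = Max (unit_reach i ` Q)" by auto
    then have ymax: "unit_reach i q \<le> unit_reach i y" if "q \<in> Q" for q using that fin by simp
    have "y \<noteq> i" using y(1) iQ by auto
    then obtain x where x: "E x y" "2 * unit_reach i y \<le> unit_reach i x"
      using unit_reach_from[of i y] ri[OF y(1)] by auto
    have xQ: "x \<notin> Q" using ymax[of x] x(2) ri[OF y(1)] by auto
    have rix: "2 \<le> unit_reach i x" using x(2) ri[OF y(1)] by simp
    then have xB: "x \<in> rich" using E_V[OF x(1)] w(3) unfolding rich_def by auto
    have ext: "x \<in> nbrs y - Q - weak_roots" by (rule extB[OF y(1) x(1) xQ xB])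
    have gy: "1 \<le> gain Q y" by (rule gx[OF y(1) ext])
    have one: "\<not> 2 \<le> cover_count q" if "q \<in> Q" for q
    proof
      assume "2 \<le> cover_count q"
      moreover from this have "q \<noteq> y" using gmx[OF y(1)] ext by blast
      ultimately show False using G2[OF that y(1)] gm[OF that] gy by linarith
    qed
    have all_ext: "z = x \<and> q = y" if "q \<in> Q" "z \<in> nbrs q - Q - weak_roots" for q z
    proof -
      have "q = y" using G2[OF that(1) y(1)] gx[OF that] gy by force
      moreover have "z = x"
      proof (rule ccontr)
        assume "z \<noteq> x"
        then have "card {z, x} \<le> card (nbrs y - Q - weak_roots)"
          using that(2) ext \<open>q = y\<close> finite_nbrs[of y] by (intro card_mono) auto
        then show False using \<open>z \<noteq> x\<close> gain_parts[OF Q y(1)] G1[OF y(1)] by simp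
      qed
      ultimately show ?thesis by simp
    qed
    have P0: "P v = 0" if "v \<in> Q" for v
    proof (rule ccontr)
      assume "P v \<noteq> 0"
      then have "v \<in> occupied" using QV[OF that] unfolding occupied_def by simp
      then show False using occ[of v] that iQ one[OF that] by auto
    qed
    have rkx: "unit_reach k x \<le> 1" if "k \<in> occupied" "k \<noteq> i" for k
      using unit_reach_to[of x y 1 k] x(1) cover_count_ge2[of k i y] that w(3) ri[OF y(1)] one[OF
        y(1)]
      by (cases "2 \<le> unit_reach k x") auto
    \<comment> \<open>A rich vertex adjacent to \<open>Q\<close> but outside it has no surplus, so
      \<open>P\<close> brings no more pebbles to \<open>x\<close> than \<open>i\<close>
      does.\<close>
    have "x \<notin> rich_surplus" using componentD(3)[OF Q y(1)] xQ E_sym[OF x(1)] by blast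
    then have "surplus x \<le> 0" using xB unfolding rich_surplus_def by auto
    then have sx: "total_reach x \<le> unit_reach i x" using surplus_single[of i x] w(3) rix rkx by simp
    have ent: "apex l = x \<and> q = y"
      if "q \<in> Q" "E (apex l) q" "apex l \<notin> Q" "apex t = apex l" "pebbling_tree E l"
        "pebbling_tree E t"
        "\<And>z. leaf_count l z + leaf_count t z \<le> P z" "size l + size t < min_cost u" for q l t
      using all_ext[OF that(1) enter[OF that]] .
    have "\<exists>M' X. size M' = size ?M \<and> forest E (\<lambda>z. if z = y then size X div 2 else 0) w M'
      \<and> forest E P x X"
      using P0 ent M(1) wQ costM by (rule cut_forest)
    then obtain M' X where MX: "size M' = size ?M"
      "forest E (\<lambda>z. if z = y then size X div 2 else 0) w M'" "forest E P x X"
      by blast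
    have "size X \<le> unit_reach i x" using forest_total_reach[OF MX(3)] sx by simp
    then have "size X div 2 \<le> unit_reach i y" using unit_reach_to[OF x(1), of "size X div 2" i]
      by simp
    then have "forest E (\<lambda>z. if z = y then reach E (unit_at P i) y else 0) w M'"
      using MX(2) by (rule_tac forest_mono[OF MX(2)]) (auto simp: unit_reach_def)
    moreover have "is_dist V (\<lambda>z. if z = y then reach E (unit_at P i) y else 0)"
      using QV[OF y(1)] unfolding is_dist_def by auto
    ultimately have "4 \<le> reach E (\<lambda>z. if z = y then reach E (unit_at P i) y else 0) w"
      using reach_ge MX(1) M(2) by simp
    then have "4 \<le> unit_reach i w" using reach_relay[OF dist_unit _ QV[OF y(1)]]
      unfolding unit_reach_def by blast
    then show False using riw by simp
  qed
  have Ple: "P v \<le> 1" if "v \<in> Q" "v \<noteq> i" for v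
    using uniq[of v v] unit_reach_self[of v] that QV[OF that(1)] unfolding occupied_def by (cases
      "P v = 0") auto
  \<comment> \<open>Without any gain nothing enters \<open>Q\<close> and only \<open>i\<close> holds
    pebbles in it, so the four pebbles on \<open>w\<close> would come from the unit at
    \<open>i\<close> alone.\<close>
  have pos: "1 \<le> (\<Sum>q\<in>Q. gain Q q)"
  proof (rule ccontr)
    assume "\<not> ?thesis"
    then have "(\<Sum>q\<in>Q. gain Q q) = 0" using sum_nonneg[of Q "gain Q"] nonneg by force
    then have g0: "gain Q q = 0" if "q \<in> Q" for q
      using sum_nonneg_eq_0_iff[of Q "gain Q"] fin nonneg that by auto
    have P0: "P v = 0" if "v \<in> Q" "v \<noteq> i" for v
      using occ[of v] gm[of v] g0[of v] QV[OF that(1)] that unfolding occupied_def by (cases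
        "P v = 0") auto
    have no: False
      if "q \<in> Q" "E (apex l) q" "apex l \<notin> Q" "apex t = apex l" "pebbling_tree E l"
        "pebbling_tree E t"
        "\<And>z. leaf_count l z + leaf_count t z \<le> P z" "size l + size t < min_cost u" for q l t
      using gx[OF that(1) enter[OF that]] g0[OF that(1)] by simp
    have out: "leaf_count t x = 0" if "t \<in># ?M" "x \<notin> Q" for t x
    proof -
      note t = leaf_count_forest[OF that(1) M(1)]
      have "apex t \<in> Q" "size t \<le> min_cost u" using t(2,4) wQ costM by auto
      with t(1,3) that(2) no show ?thesis using leaf_count_within[of Q E P "min_cost u" t x]
        by blast
    qed
    have "(\<Sum>t\<in>#?M. leaf_count t x) \<le> unit_at P i x" for x
    proof (cases "x \<in> Q")
      case True
      have "(\<Sum>t\<in>#?M. leaf_count t x) \<le> P x" using M(1) unfolding forest_def by blast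
      then show ?thesis using P0[OF True] unfolding unit_at_def by auto
    next
      case False
      then have "(\<Sum>t\<in>#?M. leaf_count t x) = 0" using out by (simp add: sum_mset_0_iff)
      then show ?thesis by linarith
    qed
    then have "forest E (unit_at P i) w ?M" using M(1) unfolding forest_def by blast
    then have "4 \<le> unit_reach i w" unfolding unit_reach_def using reach_ge[OF _ dist_unit] M(2)
      by blast
    then show False using riw by simp
  qed
  have "unit_reach i i + 1 \<le> total_reach i" using cQ[OF iQ] gain_parts(3)[OF Q iQ] by simp
  then have "P i + 1 \<le> total_reach i" using unit_reach_self[of i] by simp
  then obtain F where F: "forest E P i F" "size F = P i + 1"
    using reach_forest[OF dist, of "P i + 1" i] unfolding total_reach_def by blast
  \<comment> \<open>Some pebble reaches \<open>i\<close> without the help of the unit at \<open>i\<close>; the vertex \<open>z\<close> from which it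
    enters \<open>Q\<close> is also reached by that unit, which makes its surplus large.\<close>
  have "\<exists>t. t \<in># F \<and> leaf_count t i = 0"
  proof (rule ccontr)
    assume no: "\<not> ?thesis"
    have "1 \<le> leaf_count t i" if "t \<in># F" for t using no that
      by (metis One_nat_def Suc_leI neq0_conv)
    then have "size F \<le> (\<Sum>t\<in>#F. leaf_count t i)" by (rule size_le_sum_mset)
    also have "\<dots> \<le> P i" using F(1) unfolding forest_def by blast
    finally show False using F(2) by simp
  qed
  then obtain t where t: "t \<in># F" "leaf_count t i = 0" by blast
  note tF = leaf_count_forest[OF t(1) F(1)]
  \<comment> \<open>Emptying \<open>i\<close> leaves at most one pebble on each vertex of
    \<open>Q\<close>, while \<open>t\<close> remains available and is not a leaf.\<close>
  let ?D = "\<lambda>z. if z = i then 0 else P z"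
  have "\<exists>q z M. q \<in> Q \<and> z \<notin> Q \<and> E z q \<and> forest E ?D z M \<and> size M = 2"
  proof (rule tree_leaves_set)
    show "kids t \<noteq> {#}" using tF(2) t(2) by (cases t) auto
  qed (use Ple tF iQ t(2) in auto)
  then obtain q z M2 where z: "q \<in> Q" "z \<notin> Q" "E z q" "forest E ?D z M2" "size M2 = 2" by blast
  have dD: "is_dist V ?D" using dist unfolding is_dist_def by auto
  have "2 \<le> reach E ?D z" using reach_ge[OF z(4) dD] z(5) by simp
  moreover have "(\<lambda>x. unit_at P i x + ?D x) = P" unfolding unit_at_def by auto
  ultimately have sz: "unit_reach i z + 2 \<le> total_reach z"
    using reach_add[OF dist_unit dD, of i z] unfolding unit_reach_def total_reach_def by simp
  have riz: "1 \<le> unit_reach i z" using unit_reach_to[OF E_sym[OF z(3)], of 1 i] ri[OF z(1)] by simp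
  have zV: "z \<in> V" using E_V[OF z(3)] by simp
  have "unit_reach k z \<le> 1" if k: "k \<in> occupied" "k \<noteq> i" for k
  proof (rule ccontr)
    assume "\<not> ?thesis"
    then have k2: "2 \<le> unit_reach k z" by simp
    then have zB: "z \<in> rich" using zV k(1) unfolding rich_def by auto
    have "1 \<le> unit_reach k q" using unit_reach_to[OF z(3), of 1 k] k2 by simp
    then have "2 \<le> cover_count q" using cover_count_ge2[of k i q] k w(3) ri[OF z(1)] by simp
    then show False using gmx[OF z(1)] extB[OF z(1,3,2) zB] by blast
  qed
  then have "surplus z = int (total_reach z) - int (unit_reach i z)"
    using surplus_single[of i z] w(3) riz by simp
  then have cz: "2 \<le> surplus z" using sz by simp
  have "z \<notin> rich"
  proof
    assume "z \<in> rich"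
    then have "z \<in> rich_surplus" using cz unfolding rich_surplus_def by simp
    then show False using componentD(3)[OF Q z(1)] E_sym[OF z(3)] z(2) by blast
  qed
  then have zS: "z \<in> boosted" using zV sz unfolding boosted_def by simp
  \<comment> \<open>Origin of the 5: at most 3 pebbles on \<open>q\<close> from \<open>i\<close>, as
    4 would give the boosted \<open>z\<close> two, and a surplus of at most 2.\<close>
  then have "unit_reach i q < 4" using unit_reach_to[OF E_sym[OF z(3)], of 2 i]
    boosted_unit_reach[OF zS w(3)] by (cases "4 \<le> unit_reach i q") auto
  moreover have "surplus q \<le> 2" using gain_parts[OF Q z(1)] G1[OF z(1)] by linarith
  ultimately have "total_reach q \<le> 5" using cQ[OF z(1)] by simp
  then have "charges Q z" unfolding charges_def using zS cz z iQ w(3) riz by blast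
  then show ?thesis using pos by blast
qed

section \<open>Charging the components of small gain to boosted vertices\<close>

definition needy :: "'a set set" where
  "needy = {Q. component Q \<and> attached_roots Q \<noteq> {} \<and> (\<Sum>q\<in>Q. gain Q q) \<le> 1}"

definition charged :: "'a set \<Rightarrow> 'a" where "charged Q = (SOME z. charges Q z)"

lemma finite_components: "finite {Q. component Q}"
proof (rule finite_subset)
  show "{Q. component Q} \<subseteq> Pow rich_surplus" unfolding component_def by auto
  show "finite (Pow rich_surplus)" using finite_rich rich_surplus_rich finite_subset by auto
qed

lemma finite_needy: "finite needy"
  unfolding needy_def using finite_components by (rule rev_finite_subset) auto

lemma needy_charged: "Q \<in> needy \<Longrightarrow> charges Q (charged Q)"
  unfolding needy_def charged_def using component_gain by (auto intro: someI_ex)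

lemma card_charging_le:
  assumes "A \<subseteq> {Q. component Q}" "\<And>Q. Q \<in> A \<Longrightarrow> \<exists>x\<in>Q. x \<in> T" "finite T"
  shows "card A \<le> card T"
proof -
  obtain f where f: "\<And>Q. Q \<in> A \<Longrightarrow> f Q \<in> Q \<and> f Q \<in> T" using assms(2) by metis
  have "inj_on f A"
  proof (rule inj_onI)
    fix Q Q' assume Q: "Q \<in> A" "Q' \<in> A" "f Q = f Q'"
    then have "Q \<inter> Q' \<noteq> {}" using f[OF Q(1)] f[OF Q(2)] by auto
    then show "Q = Q'" using component_disjoint[of Q Q'] Q assms(1) by auto
  qed
  then show ?thesis using f assms(3) by (intro card_inj_on_le[of f]) auto
qed

lemma charge_bounds:
  assumes "z \<in> boosted" and A: "A = {Q \<in> needy. charged Q = z}"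
  shows "int (card A) = 0 \<or> (int (card A) \<le> int (cover_count z) \<and> int (card A)
    \<le> int (card (rich_nbrs z))
    \<and> int (card (dependents z)) + 1 \<le> int d * (surplus z - 1))"
proof (cases "A = {}")
  case False
  have ch: "charges Q z" if "Q \<in> A" for Q using that needy_charged A by auto
  have comp: "A \<subseteq> {Q. component Q}" using A unfolding needy_def by auto
  have "card A \<le> cover_count z" unfolding cover_count_def
    using comp ch finite_occupied unfolding charges_def by (intro card_charging_le) auto
  moreover have "card A \<le> card (rich_nbrs z)"
  proof (rule card_charging_le[OF comp _ finite_rich_nbrs])
    fix Q assume "Q \<in> A"
    then have "Q \<subseteq> rich" using comp componentD(1)[of Q] rich_surplus_rich by auto
    then show "\<exists>q\<in>Q. q \<in> rich_nbrs z" using ch[OF \<open>Q \<in> A\<close>]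
      unfolding charges_def rich_nbrs_def nbrs_def by blast
  qed
  moreover have "int (card (dependents z)) + 1 \<le> int d * (surplus z - 1)"
  proof -
    obtain Q where Q: "Q \<in> A" using False by blast
    then obtain q where q: "q \<in> Q" "E z q" "total_reach q \<le> 5" "2 \<le> surplus z" using ch
      unfolding charges_def by blast
    have "q \<in> rich" using Q q(1) comp componentD(1)[of Q] rich_surplus_rich by auto
    then have "q \<notin> dependents z" using boosted_rich unfolding dependents_def single_fed_def by blast
    then show ?thesis using card_dependents_bound_strict assms(1) q by blast
  qed
  ultimately show ?thesis by simp
qed simp

lemma vertex_term_nonneg: "v \<in> V \<Longrightarrow> 0 \<le> int d * surplus v + int (cover_count v - 1)"
  using surplus_nonneg by simp

lemma card_attached_roots_le:
  assumes "component Q"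
  shows "int (card (attached_roots Q)) \<le> (\<Sum>q\<in>Q. int d * surplus q + int (cover_count q - 1))
    + (if Q \<in> needy then 1 else 0)"
proof (cases "attached_roots Q = {}")
  case True
  have "Q \<subseteq> V" using componentD(1)[OF assms] rich_surplus_rich rich_V by auto
  then have "0 \<le> (\<Sum>q\<in>Q. int d * surplus q + int (cover_count q - 1))"
    by (intro sum_nonneg vertex_term_nonneg) auto
  then show ?thesis using True by simp
next
  case False
  then have "(\<Sum>q\<in>Q. gain Q q) \<ge> 2 \<or> Q \<in> needy \<and> 1 \<le> (\<Sum>q\<in>Q. gain Q q)"
    using component_gain[OF assms] assms unfolding needy_def by force
  then show ?thesis using card_attached_roots_gain[OF assms] by auto
qed

lemma card_weak_roots_le:
  "int (card weak_roots) \<le> (\<Sum>v\<in>rich. int d * surplus v + int (cover_count v - 1))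
    + int (card needy)"
proof -
  let ?C = "{Q. component Q}" and ?f = "\<lambda>v. int d * surplus v + int (cover_count v - 1)"
  have "weak_roots \<subseteq> (\<Union>Q\<in>?C. attached_roots Q)"
  proof
    fix u assume u: "u \<in> weak_roots"
    then obtain w where "w \<in> rich_surplus" "E w u" using weak_rootE by metis
    then show "u \<in> (\<Union>Q\<in>?C. attached_roots Q)" using component_exists[of w] u E_sym
      unfolding attached_roots_def by blast
  qed
  then have "card weak_roots \<le> card (\<Union>Q\<in>?C. attached_roots Q)"
    using finite_components finite_attached_roots by (intro card_mono) auto
  also have "\<dots> \<le> (\<Sum>Q\<in>?C. card (attached_roots Q))" by (rule card_UN_le[OF finite_components])
  finally have "int (card weak_roots) \<le> (\<Sum>Q\<in>?C. int (card (attached_roots Q)))"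
    unfolding of_nat_sum[symmetric] by (simp only: of_nat_le_iff)
  also have "\<dots> \<le> (\<Sum>Q\<in>?C. (\<Sum>q\<in>Q. ?f q) + (if Q \<in> needy then 1 else 0))"
    by (intro sum_mono card_attached_roots_le) auto
  also have "\<dots> = (\<Sum>Q\<in>?C. \<Sum>q\<in>Q. ?f q) + (\<Sum>Q\<in>?C. if Q \<in> needy then 1 else 0)"
    by (rule sum.distrib)
  also have "(\<Sum>Q\<in>?C. if Q \<in> needy then 1 else 0) = int (card needy)"
  proof -
    have "?C \<inter> needy = needy" unfolding needy_def by auto
    then show ?thesis using finite_components by (simp add: sum.If_cases)
  qed
  also have "(\<Sum>Q\<in>?C. \<Sum>q\<in>Q. ?f q) = (\<Sum>q\<in>\<Union>?C. ?f q)"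
  proof -
    have "\<forall>Q\<in>?C. finite Q" using component_finite by blast
    moreover have "\<forall>Q\<in>?C. \<forall>Q'\<in>?C. Q \<noteq> Q' \<longrightarrow> Q \<inter> Q' = {}" using component_disjoint by blast
    ultimately show ?thesis using sum.Union_disjoint[of ?C ?f] by simp
  qed
  also have "\<dots> \<le> (\<Sum>q\<in>rich. ?f q)"
    using componentD(1) rich_surplus_rich rich_V vertex_term_nonneg finite_rich
      by (intro sum_mono2) auto
  finally show ?thesis by simp
qed

text \<open>In the sum of the local bounds the debts of \<open>single_fed\<close> cancel against the
  dependents. The rich vertices pay for the weak roots up to \<open>card needy\<close>, which is
  exactly the number of charges that the boosted vertices absorb.\<close>

lemma card_uncovered_bound: "int (card uncovered) \<le> (\<Sum>v\<in>V. int d * surplus v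
  + int (cover_count v - 1))"
proof -
  let ?f = "\<lambda>v. int d * surplus v + int (cover_count v - 1)"
  let ?a = "\<lambda>z. int (card {Q \<in> needy. charged Q = z})"
  let ?BR = "\<lambda>u. if u \<in> weak_roots then 1 else 0" and ?T1 = "\<lambda>u. if u \<in> single_fed then 1 else 0"
  have "(\<Sum>u\<in>boosted. int d + 2 + (if u \<in> uncovered then 1 else 0))
      \<le> (\<Sum>u\<in>boosted. (2 * int (card (boosted_suppliers u)) + int (card (rich_nbrs u))) + ?f u
        + ?BR u + ?T1 u - int (card (dependents u)) - ?a u)"
  proof (rule sum_mono)
    fix u assume u: "u \<in> boosted"
    show "int d + 2 + (if u \<in> uncovered then 1 else 0)
      \<le> (2 * int (card (boosted_suppliers u)) + int (card (rich_nbrs u))) + ?f u + ?BR u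
        + ?T1 u - int (card (dependents u)) - ?a u"
      using boosted_local_bound[OF u charge_bounds[OF u refl]] by linarith
  qed
  also have "\<dots> = (\<Sum>u\<in>boosted. 2 * int (card (boosted_suppliers u)) + int (card (rich_nbrs u)))
    + (\<Sum>u\<in>boosted. ?f u) + (\<Sum>u\<in>boosted. ?BR u)
      + (\<Sum>u\<in>boosted. ?T1 u) - (\<Sum>u\<in>boosted. int (card (dependents u))) - (\<Sum>u\<in>boosted. ?a u)"
    by (simp only: sum.distrib sum_subtractf)
  also have "(\<Sum>u\<in>boosted. ?BR u) = int (card weak_roots)"
  proof -
    have "boosted \<inter> weak_roots = weak_roots" using weak_roots_boosted by auto
    then show ?thesis using finite_boosted by (simp add: sum.If_cases)
  qed
  also have "(\<Sum>u\<in>boosted. ?T1 u) = int (card single_fed)"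
  proof -
    have "boosted \<inter> single_fed = single_fed" unfolding single_fed_def by auto
    then show ?thesis using finite_boosted by (simp add: sum.If_cases)
  qed
  also have "(\<Sum>u\<in>boosted. int (card (dependents u))) = int (card single_fed)"
    unfolding of_nat_sum[symmetric] sum_card_dependents by simp
  also have "(\<Sum>u\<in>boosted. ?a u) = int (card needy)"
  proof -
    have "card needy = (\<Sum>z\<in>boosted. card {Q \<in> needy. charged Q = z})"
    proof -
      have "charged ` needy \<subseteq> boosted" using needy_charged unfolding charges_def by auto
      then show ?thesis
        using sum.group[of needy boosted charged "\<lambda>_. 1::nat"] finite_needy finite_boosted by simp
    qed
    then show ?thesis by simp
  qed
  finally have "(\<Sum>u\<in>boosted. int d + 2 + (if u \<in> uncovered then 1 else 0))
     \<le> (\<Sum>u\<in>boosted. 2 * int (card (boosted_suppliers u)) + int (card (rich_nbrs u)))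
       + (\<Sum>u\<in>boosted. ?f u) + int (card weak_roots) - int (card needy)"
    by simp
  then have "int (card uncovered) \<le> (\<Sum>u\<in>boosted. ?f u) + (\<Sum>u\<in>rich. ?f u)"
    using card_uncovered_le card_weak_roots_le by linarith
  also have "\<dots> = (\<Sum>u\<in>boosted \<union> rich. ?f u)"
    using finite_boosted finite_rich boosted_rich by (subst sum.union_disjoint) auto
  also have "\<dots> \<le> (\<Sum>u\<in>V. ?f u)"
    using boosted_V rich_V finite_V vertex_term_nonneg by (intro sum_mono2) auto
  finally show ?thesis .
qed

section \<open>From uncovered vertices to the total excess\<close>

lemma TE_eq: "is_dist V D \<Longrightarrow> TE V E D = (\<Sum>v\<in>V. int (reach E D v - 1))"
  unfolding TE_def by (simp add: exc_eq)

lemma card_V_le: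
  "int (card V) - (\<Sum>k\<in>occupied. int (cov V E (unit_at P k)))
     \<le> int d * (TE V E P - (\<Sum>k\<in>occupied. TE V E (unit_at P k)))"
proof -
  have "int (cov V E (unit_at P k)) = (\<Sum>v\<in>V. if 1 \<le> unit_reach k v then 1 else 0)" for k
    unfolding cov_def unit_reach_def using finite_V reachable_iff[OF dist_unit]
    by (simp add: sum.If_cases Int_def)
  then have "(\<Sum>k\<in>occupied. int (cov V E (unit_at P k))) = (\<Sum>k\<in>occupied. \<Sum>v\<in>V. if 1
    \<le> unit_reach k v then 1 else 0)"
    by simp
  also have "\<dots> = (\<Sum>v\<in>V. \<Sum>k\<in>occupied. if 1 \<le> unit_reach k v then 1 else 0)" by (rule sum.swap)
  also have "\<dots> = (\<Sum>v\<in>V. int (cover_count v))"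
    unfolding cover_count_def using finite_occupied by (simp add: sum.If_cases Int_def)
  finally have 1: "(\<Sum>k\<in>occupied. int (cov V E (unit_at P k))) = (\<Sum>v\<in>V. int (cover_count v))" .
  have "TE V E P - (\<Sum>k\<in>occupied. TE V E (unit_at P k))
      = (\<Sum>v\<in>V. int (total_reach v - 1)) - (\<Sum>k\<in>occupied. \<Sum>v\<in>V. int (unit_reach k v - 1))"
    using TE_eq[OF dist] TE_eq[OF dist_unit] unfolding total_reach_def unit_reach_def by simp
  also have "\<dots> = (\<Sum>v\<in>V. int (total_reach v - 1)) - (\<Sum>v\<in>V. \<Sum>k\<in>occupied. int (unit_reach k v - 1))"
    by (subst sum.swap) simp
  also have "\<dots> = (\<Sum>v\<in>V. surplus v)"
    unfolding sum_subtractf[symmetric] surplus_def using total_reach_pos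
      by (intro sum.cong) (auto simp: of_nat_diff)
  finally have 2: "TE V E P - (\<Sum>k\<in>occupied. TE V E (unit_at P k)) = (\<Sum>v\<in>V. surplus v)" .
  have "int (card V) - (\<Sum>v\<in>V. int (cover_count v)) = (\<Sum>v\<in>V. 1 - int (cover_count v))"
    by (simp add: sum_subtractf)
  \<comment> \<open>The inner subtraction is truncated and vanishes on uncovered vertices, where the
    indicator supplies the 1.\<close>
  also have "\<dots> = (\<Sum>v\<in>V. (if v \<in> uncovered then 1 else 0) - int (cover_count v - 1))"
    unfolding uncovered_def by (intro sum.cong) auto
  also have "\<dots> = int (card uncovered) - (\<Sum>v\<in>V. int (cover_count v - 1))"
  proof -
    have "V \<inter> uncovered = uncovered" using uncovered_V by auto
    then show ?thesis using finite_V by (simp add: sum_subtractf sum.If_cases)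
  qed
  also have "\<dots> \<le> (\<Sum>v\<in>V. int d * surplus v)"
    using card_uncovered_bound by (simp add: sum.distrib)
  finally show ?thesis unfolding 1 2 by (simp add: sum_distrib_left)
qed

end

theorem theorem5p1:
  fixes V :: "'a set" and E :: "'a \<Rightarrow> 'a \<Rightarrow> bool" and P :: "'a dist"
    and ws :: "'a list"
  assumes "simple_graph V E"
    and "max_degree V E \<ge> 3"
    and "is_dist V P"
    and "solvable V E P"
    and "distinct ws" and "set ws = {v \<in> V. P v > 0}"
    and "sorted (map P ws)"
  shows "real_of_int (\<Sum>i<length ws.
            CE V E (\<lambda>x. \<Sum>k<i. unit_at P (ws ! k) x) (unit_at P (ws ! i)))
         \<ge> (real (card V) - real (\<Sum>i<length ws. cov V E (unit_at P (ws ! i))))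
            / (real (max_degree V E) - 2)"
proof -
  define d where "d = max_degree V E - 2"
  interpret solvable_pebbling V E P d
  proof
    show "simple_graph V E" "is_dist V P" "solvable V E P" by fact+
    show "1 \<le> d" using assms(2) unfolding d_def by simp
    fix v assume v: "v \<in> V"
    have "finite V" using assms(1) unfolding simple_graph_def by simp
    then have "degree V E v \<le> max_degree V E" unfolding max_degree_def using v
      by (intro Max_ge) auto
    moreover have "{u \<in> V. E v u} = {u. E v u}" using assms(1) unfolding simple_graph_def by auto
    ultimately show "card {u. E v u} \<le> d + 2" unfolding degree_def d_def by simp
  qed
  have occupied: "set ws = occupied" unfolding occupied_def by (rule assms(6))
  have over_occupied: "(\<Sum>i<length ws. f (ws ! i)) = (\<Sum>k\<in>occupied. f k)" for f :: "'a \<Rightarrow> 'b::comm_monoid_add"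
    using sum.reindex_bij_betw[OF bij_betw_nth[OF assms(5) refl occupied[symmetric]], of f] by simp
  have "(\<Sum>i<n. CE V E (\<lambda>x. \<Sum>k<i. unit_at P (ws ! k) x) (unit_at P (ws ! i)))
      = TE V E (\<lambda>x. \<Sum>k<n. unit_at P (ws ! k) x) - (\<Sum>i<n. TE V E (unit_at P (ws ! i)))" for n
  proof (induction n)
    case 0
    have "is_dist V (\<lambda>_. 0)" unfolding is_dist_def by simp
    then have "TE V E (\<lambda>_. 0) = 0" by (simp add: TE_eq reach_zero)
    then show ?case by simp
  qed (simp add: CE_def)
  moreover have "(\<lambda>x. \<Sum>k<length ws. unit_at P (ws ! k) x) = P"
  proof
    fix x
    have "(\<Sum>k<length ws. unit_at P (ws ! k) x) = (\<Sum>k\<in>occupied. if k = x then P x else 0)"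
      unfolding over_occupied[of "\<lambda>k. unit_at P k x"] by (intro sum.cong) (auto simp: unit_at_def)
    also have "\<dots> = (if x \<in> occupied then P x else 0)" using finite_occupied by simp
    also have "\<dots> = P x" using assms(3) unfolding occupied_def is_dist_def by auto
    finally show "(\<Sum>k<length ws. unit_at P (ws ! k) x) = P x" .
  qed
  ultimately have CE: "(\<Sum>i<length ws. CE V E (\<lambda>x. \<Sum>k<i. unit_at P (ws ! k) x) (unit_at P (ws ! i)))
      = TE V E P - (\<Sum>k\<in>occupied. TE V E (unit_at P k))"
    by (simp only: over_occupied[of "\<lambda>k. TE V E (unit_at P k)"])
  let ?T = "TE V E P - (\<Sum>k\<in>occupied. TE V E (unit_at P k))"
  have "real_of_int (int (card V) - (\<Sum>k\<in>occupied. int (cov V E (unit_at P k))))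
    \<le> real_of_int (int d * ?T)"
    using card_V_le by (simp only: of_int_le_iff)
  then have "real (card V) - real (\<Sum>k\<in>occupied. cov V E (unit_at P k)) \<le> real d * real_of_int ?T"
    by simp
  moreover have "real d = real (max_degree V E) - 2" "0 < real d" using assms(2) unfolding d_def
    by auto
  ultimately show ?thesis unfolding CE over_occupied[of "\<lambda>k. cov V E (unit_at P k)"]
    by (simp add: field_simps)
qed

end
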